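(* Let $m,n\ge1$ and, for each $j=1,\dots,m$, suppose that $L_j:\mathbb{R}^n\to\mathbb{R}^{n_j}$ is a surjective linear transformation and $p_j$ is a nonnegative exponent. Suppose further that for each $j=1,\dots,m$, $A_j$ is a (symmetric) positive-definite linear transformation on $\mathbb{R}^{n_j}$ such that $$M:=\sum_{j=1}^mp_jL_j^*A_jL_j$$ is invertible, and $$L_jM^{-1}L_j^*\le A_j^{-1}\qquad\text{for each }j=1,\dots,m.$$ Let $u_j:\mathbb{R}_+\times\mathbb{R}^{n_j}\to\mathbb{R}_+$ for $j=1,\dots,m$, and let $\widetilde u:\mathbb{R}_+\times\mathbb{R}^n\to\mathbb{R}_+$ be $$\widetilde u(t,x):=t^{\frac12\left(\sum_{j=1}^mp_jn_j-n\right)}\prod_{j=1}^mu_j(t,L_jx)^{p_j}.$$ If $$\partial_tu_j\ge\operatorname{div}(A_j^{-1}\nabla u_j)\quad\text{and}\quad D^2(\log u_j)\ge-\frac{A_j}{2t}$$ for all $j=1,\dots,m$, then $$\partial_t\widetilde u\ge\operatorname{div}(M^{-1}\nabla\widetilde u)\quad\text{and}\quad D^2(\log\widetilde u)\ge-\frac{M}{2t}.$$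
   Context: $\mathbb{R}_+=(0,\infty)$. Time is $t\in\mathbb{R}_+$; $\operatorname{div}$, $\nabla$ and the Hessian $D^2$ act in the space variable only (on $\mathbb{R}^{n_j}$ for $u_j$, on $\mathbb{R}^n$ for $\widetilde u$). $L_j^*$ is the adjoint (transpose) of $L_j$. All functions $u_j$ are assumed sufficiently regular (once continuously differentiable in $t$ and twice continuously differentiable in the space variable). Matrix inequalities $P\ge Q$ mean that $P-Q$ is positive semidefinite, and inequalities for functions are required or asserted at every point. *)

theory Defs
  imports
    "HOL-Analysis.Analysis"
    "Jordan_Normal_Form.Gauss_Jordan_Elimination"
begin

unbundle no vec_syntax
no_notation Inner_Product.real_inner_class.inner (infix \<open>\<bullet>\<close> 70)
hide_const (open) Finite_Cartesian_Product.vec Finite_Cartesian_Product.mat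
  Determinants.det

text \<open>
  The space \<open>\<real>\<^sup>d\<close>, with \<open>d\<close> a natural number, is \<open>carrier_vec d\<close>, and linear maps
  \<open>\<real>\<^sup>d \<rightarrow> \<real>\<^sup>e\<close> are their matrices in \<open>carrier_mat e d\<close>. Adjoints are
  transposes. Coordinates are numbered from \<open>0\<close> to \<open>d - 1\<close>.
\<close>

text \<open>Only meaningful for invertible \<open>A\<close>; then it is the two-sided inverse of \<open>A\<close>.\<close>

definition minv :: "real mat \<Rightarrow> real mat" where
  "minv A = the (mat_inverse A)"

definition symm_mat :: "nat \<Rightarrow> real mat \<Rightarrow> bool" where
  "symm_mat d A \<longleftrightarrow> A \<in> carrier_mat d d \<and> A\<^sup>T = A"

definition pos_def :: "nat \<Rightarrow> real mat \<Rightarrow> bool" where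
  "pos_def d A \<longleftrightarrow> symm_mat d A \<and>
     (\<forall>x \<in> carrier_vec d. x \<noteq> 0\<^sub>v d \<longrightarrow> x \<bullet> (A *\<^sub>v x) > 0)"

definition pos_semidef :: "nat \<Rightarrow> real mat \<Rightarrow> bool" where
  "pos_semidef d A \<longleftrightarrow> symm_mat d A \<and>
     (\<forall>x \<in> carrier_vec d. x \<bullet> (A *\<^sub>v x) \<ge> 0)"

definition loewner_ge :: "nat \<Rightarrow> real mat \<Rightarrow> real mat \<Rightarrow> bool" where
  "loewner_ge d P Q \<longleftrightarrow>
     P \<in> carrier_mat d d \<and> Q \<in> carrier_mat d d \<and> pos_semidef d (P - Q)"

text \<open>The restriction of \<open>f\<close> to the line through \<open>x\<close> in the \<open>i\<close>-th coordinate direction.\<close>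

definition along :: "nat \<Rightarrow> (real vec \<Rightarrow> real) \<Rightarrow> real vec \<Rightarrow> real \<Rightarrow> real" where
  "along i f x = (\<lambda>s. f (x + s \<cdot>\<^sub>v unit_vec (dim_vec x) i))"

definition pd :: "nat \<Rightarrow> (real vec \<Rightarrow> real) \<Rightarrow> real vec \<Rightarrow> real" where
  "pd i f x = deriv (along i f x) 0"

definition grad :: "(real vec \<Rightarrow> real) \<Rightarrow> real vec \<Rightarrow> real vec" where
  "grad f x = vec (dim_vec x) (\<lambda>i. pd i f x)"

definition divergence :: "(real vec \<Rightarrow> real vec) \<Rightarrow> real vec \<Rightarrow> real" where
  "divergence F x = (\<Sum>i<dim_vec x. pd i (\<lambda>y. F y $ i) x)"

definition hessian :: "(real vec \<Rightarrow> real) \<Rightarrow> real vec \<Rightarrow> real mat" where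
  "hessian f x = mat (dim_vec x) (dim_vec x) (\<lambda>(i, k). pd i (pd k f) x)"

text \<open>
  The type \<^typ>\<open>real vec\<close> carries no topology. Continuity of \<open>f\<close> on \<open>\<real>\<^sup>d\<close> is
  expressed through the product topology on \<^typ>\<open>nat \<Rightarrow> real\<close>: the map
  \<open>z \<mapsto> vec d z\<close> reads only the first \<open>d\<close> coordinates of \<open>z\<close>, so the Euclidean topology of
  \<open>\<real>\<^sup>d\<close> is the quotient topology under it.
\<close>

definition cont_fn :: "nat \<Rightarrow> (real vec \<Rightarrow> real) \<Rightarrow> bool" where
  "cont_fn d f \<longleftrightarrow> continuous_on UNIV (\<lambda>z :: nat \<Rightarrow> real. f (vec d z))"

definition C1_fn :: "nat \<Rightarrow> (real vec \<Rightarrow> real) \<Rightarrow> bool" where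
  "C1_fn d f \<longleftrightarrow>
     (\<forall>i<d. (\<forall>x \<in> carrier_vec d. along i f x differentiable (at 0)) \<and> cont_fn d (pd i f))"

definition C2_fn :: "nat \<Rightarrow> (real vec \<Rightarrow> real) \<Rightarrow> bool" where
  "C2_fn d f \<longleftrightarrow> C1_fn d f \<and> (\<forall>i<d. C1_fn d (pd i f))"

text \<open>
  Once continuously differentiable in \<open>t > 0\<close> for fixed \<open>x\<close>, and twice continuously
  differentiable in \<open>x\<close> for fixed \<open>t > 0\<close>. No joint continuity in \<open>(t, x)\<close> is required.
\<close>

definition regular :: "nat \<Rightarrow> (real \<Rightarrow> real vec \<Rightarrow> real) \<Rightarrow> bool" where
  "regular d u \<longleftrightarrow>
     (\<forall>x \<in> carrier_vec d. (\<lambda>t. u t x) C1_differentiable_on {0<..}) \<and>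
     (\<forall>t>0. C2_fn d (u t))"

text \<open>\<open>\<partial>\<^sub>t u \<ge> div (B \<nabla>u)\<close> at every point of \<open>(0, \<infinity>) \<times> \<real>\<^sup>d\<close>.\<close>

definition heat_supersol :: "nat \<Rightarrow> real mat \<Rightarrow> (real \<Rightarrow> real vec \<Rightarrow> real) \<Rightarrow> bool" where
  "heat_supersol d B u \<longleftrightarrow> (\<forall>t>0. \<forall>x \<in> carrier_vec d.
     deriv (\<lambda>s. u s x) t \<ge> divergence (\<lambda>y. B *\<^sub>v grad (u t) y) x)"

text \<open>\<open>D\<^sup>2 (log u) \<ge> - A / (2 t)\<close> at every point of \<open>(0, \<infinity>) \<times> \<real>\<^sup>d\<close>.\<close>

definition log_hessian_bound :: "nat \<Rightarrow> real mat \<Rightarrow> (real \<Rightarrow> real vec \<Rightarrow> real) \<Rightarrow> bool" where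
  "log_hessian_bound d A u \<longleftrightarrow> (\<forall>t>0. \<forall>x \<in> carrier_vec d.
     loewner_ge d (hessian (\<lambda>y. ln (u t y)) x) (- (1 / (2 * t)) \<cdot>\<^sub>m A))"

text \<open>Matrices of varying size form no additive monoid as a type, hence the entrywise sum.\<close>

definition mat_setsum :: "nat \<Rightarrow> (nat \<Rightarrow> real mat) \<Rightarrow> nat set \<Rightarrow> real mat" where
  "mat_setsum d B J = mat d d (\<lambda>ik. \<Sum>j\<in>J. B j $$ ik)"

end

theory Submission
  imports Defs "Jordan_Normal_Form.Determinant"
begin

text \<open>
  Pass to logarithms. With \<open>v\<^sub>j = ln u\<^sub>j\<close> and \<open>v = ln u'\<close>, the product becomes the sum
  \<open>v(t, x) = a ln t + \<Sum>\<^sub>j p\<^sub>j v\<^sub>j(t, L\<^sub>j x)\<close> with \<open>2a = \<Sum>\<^sub>j p\<^sub>j n\<^sub>j - n\<close>, so its gradient and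
  Hessian are \<open>\<Sum>\<^sub>j p\<^sub>j L\<^sub>j\<^sup>* w\<^sub>j\<close> and \<open>\<Sum>\<^sub>j p\<^sub>j L\<^sub>j\<^sup>* H\<^sub>j L\<^sub>j\<close>, where \<open>w\<^sub>j\<close> and \<open>H\<^sub>j\<close> are the gradient
  and Hessian of \<open>v\<^sub>j\<close> at \<open>L\<^sub>j x\<close> (\<open>second_order_pull\<close>). The bound on the Hessian of \<open>v\<close> is
  then the sum of the pulled back bounds on the \<open>H\<^sub>j\<close>.

  For a positive function \<open>w = e\<^sup>v\<close> one has
  \<open>div (B \<nabla>w) = w (tr (B D\<^sup>2v) + \<langle>B \<nabla>v, \<nabla>v\<rangle>)\<close> (\<open>divergence_via_log\<close>). Hence the heat inequality
  for \<open>u'\<close> follows from those for the \<open>u\<^sub>j\<close> once the following two purely algebraic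
  inequalities are known.

  \<^item> \<open>trace_inequality\<close>: the trace term at \<open>M\<^sup>-\<^sup>1\<close> is
    \<open>\<Sum>\<^sub>j p\<^sub>j tr (L\<^sub>j M\<^sup>-\<^sup>1 L\<^sub>j\<^sup>* H\<^sub>j)\<close>. Replacing \<open>L\<^sub>j M\<^sup>-\<^sup>1 L\<^sub>j\<^sup>*\<close> by the larger \<open>A\<^sub>j\<^sup>-\<^sup>1\<close> costs something
    only because \<open>H\<^sub>j\<close> may be negative, and \<open>H\<^sub>j \<ge> -A\<^sub>j / 2t\<close> limits the cost. As the trace of
    a product of two positive semidefinite matrices is nonnegative, the total cost is at most
    \<open>1/2t \<Sum>\<^sub>j p\<^sub>j tr ((A\<^sub>j\<^sup>-\<^sup>1 - L\<^sub>j M\<^sup>-\<^sup>1 L\<^sub>j\<^sup>*) A\<^sub>j) = 1/2t (\<Sum>\<^sub>j p\<^sub>j n\<^sub>j - tr (M\<^sup>-\<^sup>1 M)) = a/t\<close>,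
    which is exactly what the factor \<open>t\<^sup>a\<close> contributes to \<open>\<partial>\<^sub>t v\<close>.

  \<^item> \<open>gradient_inequality\<close>: with \<open>y = M\<^sup>-\<^sup>1 \<Sum>\<^sub>j p\<^sub>j L\<^sub>j\<^sup>* w\<^sub>j\<close>, expanding
    \<open>0 \<le> \<Sum>\<^sub>j p\<^sub>j \<langle>A\<^sub>j z\<^sub>j, z\<^sub>j\<rangle>\<close> for \<open>z\<^sub>j = L\<^sub>j y - A\<^sub>j\<^sup>-\<^sup>1 w\<^sub>j\<close> gives
    \<open>\<langle>M y, y\<rangle> \<le> \<Sum>\<^sub>j p\<^sub>j \<langle>A\<^sub>j\<^sup>-\<^sup>1 w\<^sub>j, w\<^sub>j\<rangle>\<close>.

  The calculus rests on one analytic fact: a function with continuous partial derivatives has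
  directional derivatives that are linear in the direction (\<open>C1_fn_has_grad\<close>). This is what the
  chain rule for \<open>v\<^sub>j(t, L\<^sub>j x)\<close> requires.
\<close>

section \<open>Positive semidefinite matrices and the Frobenius pairing\<close>

text \<open>
  The quadratic form at \<open>e\<^sub>i + s e\<^sub>j\<close> is \<open>P i i + 2 s P i j\<close>, affine in \<open>s\<close>; it stays
  nonnegative for all \<open>s\<close> only if the slope vanishes.
\<close>

lemma psd_zero_diagonal_entry:
  fixes P :: "nat \<Rightarrow> nat \<Rightarrow> real"
  assumes sym: "\<And>i k. i < d \<Longrightarrow> k < d \<Longrightarrow> P i k = P k i"
    and psd: "\<And>x. (\<Sum>i<d. \<Sum>k<d. P i k * x i * x k) \<ge> 0"
    and ij: "i < d" "j < d" and zero: "P j j = 0"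
  shows "P i j = 0"
proof (rule ccontr)
  assume nz: "P i j \<noteq> 0"
  then have ne: "i \<noteq> j" using zero by auto
  \<comment> \<open>the value of \<open>s\<close> at which \<open>P i i + 2 s P i j = -1\<close>\<close>
  define s where "s = - (P i i + 1) / (2 * P i j)"
  define x where "x = (\<lambda>k. if k = i then 1 else if k = j then s else 0)"
  have inner: "(\<Sum>k<d. P a k * x a * x k) = P a i * x a + P a j * x a * s" for a
  proof -
    have "(\<Sum>k<d. P a k * x a * x k) = (\<Sum>k\<in>{i, j}. P a k * x a * x k)"
      by (rule sum.mono_neutral_right) (use ij in \<open>auto simp: x_def\<close>)
    then show ?thesis using ne by (simp add: x_def)
  qed
  have "(\<Sum>a<d. \<Sum>k<d. P a k * x a * x k) = (\<Sum>a\<in>{i, j}. P a i * x a + P a j * x a * s)"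
    unfolding inner by (rule sum.mono_neutral_right) (use ij in \<open>auto simp: x_def\<close>)
  also have "\<dots> = P i i + 2 * s * P i j"
    using ne zero sym[OF ij] by (simp add: x_def)
  also have "\<dots> = -1" using nz by (simp add: s_def field_simps)
  finally show False using psd[of x] by simp
qed

text \<open>
  One step of symmetric Gaussian elimination: splitting off the last column writes
  \<open>P = R + v v\<^sup>T / c\<close> with pivot \<open>c = P d d\<close> and column \<open>v\<close>, where the Schur complement \<open>R\<close> is
  positive semidefinite with zero last row and column. The rank-one part pairs with \<open>Q\<close> to the
  value of the quadratic form of \<open>Q\<close> at \<open>v\<close>, divided by \<open>c\<close>, and \<open>R\<close> is handled by induction. A zero pivot
  forces \<open>v = 0\<close>, and then the convention \<open>x / 0 = 0\<close> keeps all formulas correct.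
\<close>

lemma sum_prod_psd_nonneg:
  fixes P Q :: "nat \<Rightarrow> nat \<Rightarrow> real"
  assumes "\<And>i k. i < d \<Longrightarrow> k < d \<Longrightarrow> P i k = P k i"
    and "\<And>x. (\<Sum>i<d. \<Sum>k<d. P i k * x i * x k) \<ge> 0"
    and "\<And>x. (\<Sum>i<d. \<Sum>k<d. Q i k * x i * x k) \<ge> 0"
  shows "(\<Sum>i<d. \<Sum>k<d. P i k * Q i k) \<ge> 0"
  using assms
proof (induction d arbitrary: P)
  case 0
  then show ?case by simp
next
  case (Suc d)
  note sym = Suc.prems(1) and psd = Suc.prems(2) and psdQ = Suc.prems(3)
  define c where "c = P d d"
  have col: "c = 0 \<Longrightarrow> P i d = 0" if "i < Suc d" for i
    using psd_zero_diagonal_entry[of "Suc d" P i d] sym psd that by (auto simp: c_def)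
  have c0: "c \<ge> 0"
    using psd[of "\<lambda>i. if i = d then 1 else 0"]
    by (simp add: c_def if_distrib sum.delta cong: if_cong)
  define R where "R = (\<lambda>i k. P i k - P i d * P k d / c)"
  have Rsym: "R i k = R k i" if "i < Suc d" "k < Suc d" for i k
    using sym that by (simp add: R_def mult.commute)
  have Rd: "R i d = 0" if "i < Suc d" for i
    using col[OF that] by (auto simp: R_def c_def)
  have Rpsd: "(\<Sum>i<d. \<Sum>k<d. R i k * x i * x k) \<ge> 0" for x
  proof -
    define S where "S = (\<Sum>i<d. P i d * x i)"
    \<comment> \<open>the last coordinate that minimizes the quadratic form of \<open>P\<close> for given first \<open>d\<close> coordinates\<close>
    define y where "y = x(d := - S / c)"
    have yd: "y d = - S / c" and yi: "\<And>i. i < d \<Longrightarrow> y i = x i" by (auto simp: y_def)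
    have S0: "c = 0 \<Longrightarrow> S = 0" using col by (simp add: S_def)
    have S': "(\<Sum>k<d. P d k * x k) = S"
      unfolding S_def using sym by (intro sum.cong) auto
    have "(\<Sum>i<Suc d. \<Sum>k<Suc d. P i k * y i * y k)
        = (\<Sum>i<d. \<Sum>k<d. P i k * x i * x k) + (\<Sum>i<d. P i d * x i * y d)
          + (\<Sum>k<d. P d k * y d * x k) + c * y d * y d"
      by (simp add: sum.distrib yi c_def)
    also have "(\<Sum>i<d. P i d * x i * y d) = S * y d" by (simp add: S_def sum_distrib_right)
    also have "(\<Sum>k<d. P d k * y d * x k) = S * y d"
      unfolding S'[symmetric] sum_distrib_right by (simp add: mult_ac)
    also have "(\<Sum>i<d. \<Sum>k<d. P i k * x i * x k) + S * y d + S * y d + c * y d * y d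
       = (\<Sum>i<d. \<Sum>k<d. P i k * x i * x k) - S * S / c"
      using S0 by (cases "c = 0") (auto simp: yd field_simps)
    also have "S * S / c = (\<Sum>i<d. \<Sum>k<d. P i d * P k d / c * x i * x k)"
      unfolding S_def sum_product sum_divide_distrib by (simp add: mult_ac)
    also have "(\<Sum>i<d. \<Sum>k<d. P i k * x i * x k) - \<dots> = (\<Sum>i<d. \<Sum>k<d. R i k * x i * x k)"
      by (simp add: R_def sum_subtractf[symmetric] algebra_simps)
    finally show ?thesis using psd[of y] by simp
  qed
  have Qpsd: "(\<Sum>i<d. \<Sum>k<d. Q i k * x i * x k) \<ge> 0" for x
    using psdQ[of "x(d := 0)"] by simp
  have IH: "(\<Sum>i<d. \<Sum>k<d. R i k * Q i k) \<ge> 0"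
    by (rule Suc.IH) (use Rsym Rpsd Qpsd in auto)
  have "(\<Sum>i<Suc d. \<Sum>k<Suc d. P i k * Q i k)
     = (\<Sum>i<Suc d. \<Sum>k<Suc d. R i k * Q i k)
       + (\<Sum>i<Suc d. \<Sum>k<Suc d. Q i k * P i d * P k d) / c"
    unfolding sum_divide_distrib sum.distrib[symmetric]
    by (intro sum.cong refl) (simp add: R_def algebra_simps)
  moreover have "(\<Sum>i<Suc d. \<Sum>k<Suc d. R i k * Q i k) = (\<Sum>i<d. \<Sum>k<d. R i k * Q i k)"
  proof -
    have "R d k = 0" if "k < Suc d" for k using Rsym[of d k] Rd[of k] that by simp
    then show ?thesis using Rd by simp
  qed
  ultimately show ?case using IH psdQ[of "\<lambda>i. P i d"] c0 by simp
qed

text \<open>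
  The pairing \<open>tr (P Q\<^sup>T)\<close>, which is \<open>tr (P Q)\<close> for symmetric \<open>Q\<close>.
\<close>

definition frob :: "real mat \<Rightarrow> real mat \<Rightarrow> real" where
  "frob P Q = (\<Sum>i<dim_row P. \<Sum>k<dim_col P. P $$ (i, k) * Q $$ (i, k))"

lemma quad_form_sum:
  fixes A :: "real mat"
  assumes "A \<in> carrier_mat d d" "x \<in> carrier_vec d"
  shows "x \<bullet> (A *\<^sub>v x) = (\<Sum>i<d. \<Sum>k<d. A $$ (i, k) * x $ i * x $ k)"
  using assms by (auto simp: scalar_prod_def lessThan_atLeast0 sum_distrib_left mult_ac intro!: sum.cong)

lemma symm_matD: "symm_mat d A \<Longrightarrow> i < d \<Longrightarrow> k < d \<Longrightarrow> A $$ (i, k) = A $$ (k, i)"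
  unfolding symm_mat_def by (metis carrier_matD index_transpose_mat(1))

lemma pos_semidef_quad_form_sum:
  assumes "pos_semidef d P"
  shows "(\<Sum>i<d. \<Sum>k<d. P $$ (i, k) * x i * x k) \<ge> 0"
proof -
  have "vec d x \<bullet> (P *\<^sub>v vec d x) = (\<Sum>i<d. \<Sum>k<d. P $$ (i, k) * x i * x k)"
    using assms by (subst quad_form_sum[of _ d]) (auto simp: pos_semidef_def symm_mat_def)
  then show ?thesis using assms by (metis pos_semidef_def vec_carrier)
qed

lemma frob_pos_semidef:
  assumes P: "pos_semidef d P" and Q: "pos_semidef d Q"
  shows "frob P Q \<ge> 0"
proof -
  have "(\<Sum>i<d. \<Sum>k<d. P $$ (i, k) * Q $$ (i, k)) \<ge> 0"
    by (rule sum_prod_psd_nonneg)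
      (use P Q pos_semidef_quad_form_sum symm_matD in \<open>auto simp: pos_semidef_def\<close>)
  moreover have "P \<in> carrier_mat d d" using P by (simp add: pos_semidef_def symm_mat_def)
  ultimately show ?thesis by (simp add: frob_def)
qed

lemma index_triple_product:
  fixes K :: "real mat"
  assumes "K \<in> carrier_mat a d" "P \<in> carrier_mat d e" "R \<in> carrier_mat e b" "i < a" "k < b"
  shows "(K * P * R) $$ (i, k) = (\<Sum>r<d. \<Sum>s<e. K $$ (i, r) * P $$ (r, s) * R $$ (s, k))"
proof -
  have "(K * P * R) $$ (i, k) = (\<Sum>s<e. (\<Sum>r<d. K $$ (i, r) * P $$ (r, s)) * R $$ (s, k))"
    using assms by (auto simp: scalar_prod_def lessThan_atLeast0 simp del: assoc_mult_mat intro!: sum.cong)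
  also have "\<dots> = (\<Sum>r<d. \<Sum>s<e. K $$ (i, r) * P $$ (r, s) * R $$ (s, k))"
    unfolding sum_distrib_right by (rule sum.swap)
  finally show ?thesis .
qed

lemma index_congruence:
  fixes K :: "real mat"
  assumes "K \<in> carrier_mat d n" "Q \<in> carrier_mat d d" "i < n" "k < n"
  shows "(K\<^sup>T * Q * K) $$ (i, k) = (\<Sum>r<d. \<Sum>s<d. K $$ (r, i) * Q $$ (r, s) * K $$ (s, k))"
  using index_triple_product[of "K\<^sup>T" n d Q d K n i k] assms by auto

text \<open>
  Cyclicity of the trace; the form in which matrices are moved across \<open>L\<^sub>j\<close>.
\<close>

lemma frob_congruence:
  assumes K: "K \<in> carrier_mat d n" and P: "P \<in> carrier_mat n n" and Q: "Q \<in> carrier_mat d d"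
  shows "frob P (K\<^sup>T * Q * K) = frob (K * P * K\<^sup>T) Q"
proof -
  let ?t = "\<lambda>i k r s. K $$ (r, i) * P $$ (i, k) * K $$ (s, k) * Q $$ (r, s)"
  have "frob P (K\<^sup>T * Q * K) = (\<Sum>i<n. \<Sum>k<n. \<Sum>r<d. \<Sum>s<d. ?t i k r s)"
    unfolding frob_def carrier_matD[OF P]
    by (intro sum.cong refl) (simp add: index_congruence[OF K Q] sum_distrib_left mult_ac)
  also have "\<dots> = (\<Sum>i<n. \<Sum>r<d. \<Sum>k<n. \<Sum>s<d. ?t i k r s)"
    by (intro sum.cong refl sum.swap)
  also have "\<dots> = (\<Sum>r<d. \<Sum>i<n. \<Sum>k<n. \<Sum>s<d. ?t i k r s)"
    by (rule sum.swap)
  also have "\<dots> = (\<Sum>r<d. \<Sum>i<n. \<Sum>s<d. \<Sum>k<n. ?t i k r s)"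
    by (intro sum.cong refl sum.swap)
  also have "\<dots> = (\<Sum>r<d. \<Sum>s<d. \<Sum>i<n. \<Sum>k<n. ?t i k r s)"
    by (intro sum.cong refl sum.swap)
  also have "\<dots> = frob (K * P * K\<^sup>T) Q"
  proof -
    have "(K * P * K\<^sup>T) $$ (r, s) * Q $$ (r, s) = (\<Sum>i<n. \<Sum>k<n. ?t i k r s)"
      if "r < d" "s < d" for r s
      using that K by (subst index_triple_product[OF K P, of "K\<^sup>T" d])
        (auto simp: sum_distrib_right intro!: sum.cong)
    then show ?thesis using K P by (simp add: frob_def)
  qed
  finally show ?thesis .
qed

lemma frob_inverse:
  assumes B: "B \<in> carrier_mat d d" and A: "symm_mat d A" and BA: "B * A = 1\<^sub>m d"
  shows "frob B A = real d"
proof -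
  have "(\<Sum>k<d. B $$ (i, k) * A $$ (i, k)) = 1" if "i < d" for i
  proof -
    have "(B * A) $$ (i, i) = (\<Sum>k<d. B $$ (i, k) * A $$ (k, i))"
      using A B that by (auto simp: symm_mat_def scalar_prod_def lessThan_atLeast0)
    also have "\<dots> = (\<Sum>k<d. B $$ (i, k) * A $$ (i, k))"
      using symm_matD[OF A] that by (intro sum.cong) auto
    finally show ?thesis using BA that by simp
  qed
  then show ?thesis using B by (simp add: frob_def)
qed

lemma frob_diff_left:
  "\<lbrakk>P \<in> carrier_mat d d; P' \<in> carrier_mat d d\<rbrakk> \<Longrightarrow> frob (P - P') Q = frob P Q - frob P' Q"
  by (simp add: frob_def sum_subtractf[symmetric] left_diff_distrib)

lemma frob_diff_right:
  "\<lbrakk>P \<in> carrier_mat d d; Q \<in> carrier_mat d d; Q' \<in> carrier_mat d d\<rbrakk> \<Longrightarrow>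
    frob P (Q - Q') = frob P Q - frob P Q'"
  by (simp add: frob_def sum_subtractf[symmetric] right_diff_distrib)

lemma frob_smult_right:
  "\<lbrakk>P \<in> carrier_mat d d; Q \<in> carrier_mat d d\<rbrakk> \<Longrightarrow> frob P (c \<cdot>\<^sub>m Q) = c * frob P Q"
  by (simp add: frob_def sum_distrib_left mult_ac)

lemma frob_mat_setsum:
  assumes "P \<in> carrier_mat d d"
  shows "frob P (mat_setsum d B J) = (\<Sum>j\<in>J. frob P (B j))"
proof -
  have "frob P (mat_setsum d B J) = (\<Sum>i<d. \<Sum>k<d. \<Sum>j\<in>J. P $$ (i, k) * B j $$ (i, k))"
    using assms by (simp add: frob_def mat_setsum_def sum_distrib_left)
  also have "\<dots> = (\<Sum>i<d. \<Sum>j\<in>J. \<Sum>k<d. P $$ (i, k) * B j $$ (i, k))"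
    by (intro sum.cong refl sum.swap)
  also have "\<dots> = (\<Sum>j\<in>J. \<Sum>i<d. \<Sum>k<d. P $$ (i, k) * B j $$ (i, k))"
    by (rule sum.swap)
  finally show ?thesis using assms by (simp add: frob_def)
qed

lemma mat_setsum_carrier [simp]: "mat_setsum d B J \<in> carrier_mat d d"
  by (simp add: mat_setsum_def)

lemma quad_form_mat_setsum:
  assumes x: "x \<in> carrier_vec d" and B: "\<And>j. j \<in> J \<Longrightarrow> B j \<in> carrier_mat d d"
  shows "x \<bullet> (mat_setsum d B J *\<^sub>v x) = (\<Sum>j\<in>J. x \<bullet> (B j *\<^sub>v x))"
proof -
  have "x \<bullet> (mat_setsum d B J *\<^sub>v x)
    = (\<Sum>i<d. \<Sum>k<d. \<Sum>j\<in>J. B j $$ (i, k) * x $ i * x $ k)"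
    using x by (simp add: quad_form_sum[of _ d] mat_setsum_def sum_distrib_right)
  also have "\<dots> = (\<Sum>i<d. \<Sum>j\<in>J. \<Sum>k<d. B j $$ (i, k) * x $ i * x $ k)"
    by (intro sum.cong refl sum.swap)
  also have "\<dots> = (\<Sum>j\<in>J. \<Sum>i<d. \<Sum>k<d. B j $$ (i, k) * x $ i * x $ k)"
    by (rule sum.swap)
  also have "\<dots> = (\<Sum>j\<in>J. x \<bullet> (B j *\<^sub>v x))"
    by (intro sum.cong refl quad_form_sum[symmetric] B x)
  finally show ?thesis .
qed

lemma pos_semidef_mat_setsum:
  assumes B: "\<And>j. j \<in> J \<Longrightarrow> pos_semidef d (B j)"
  shows "pos_semidef d (mat_setsum d B J)"
proof -
  have "symm_mat d (mat_setsum d B J)"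
    using symm_matD[of d "B _"] B
    by (auto simp: symm_mat_def mat_setsum_def pos_semidef_def intro!: eq_matI sum.cong)
  then show ?thesis
    using B by (auto simp: pos_semidef_def symm_mat_def quad_form_mat_setsum intro!: sum_nonneg)
qed

lemma scalar_prod_smult_mat:
  fixes P :: "real mat"
  assumes "P \<in> carrier_mat d d" "x \<in> carrier_vec d"
  shows "x \<bullet> ((c \<cdot>\<^sub>m P) *\<^sub>v x) = c * (x \<bullet> (P *\<^sub>v x))"
  using assms by (simp add: quad_form_sum[of _ d] sum_distrib_left mult_ac)

lemma pos_semidef_smult:
  assumes "pos_semidef d P" "c \<ge> 0"
  shows "pos_semidef d (c \<cdot>\<^sub>m P)"
  using assms symm_matD[of d P] unfolding pos_semidef_def
  by (auto simp: symm_mat_def scalar_prod_smult_mat intro!: eq_matI)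

lemma scalar_prod_transpose:
  fixes K :: "real mat"
  assumes "K \<in> carrier_mat d n" "x \<in> carrier_vec n" "y \<in> carrier_vec d"
  shows "x \<bullet> (K\<^sup>T *\<^sub>v y) = (K *\<^sub>v x) \<bullet> y"
  using transpose_vec_mult_scalar[OF assms] assms comm_scalar_prod[of x n "K\<^sup>T *\<^sub>v y"]
    comm_scalar_prod[of "K *\<^sub>v x" d y] by simp

lemma quad_form_congruence:
  fixes K :: "real mat"
  assumes "K \<in> carrier_mat d n" "P \<in> carrier_mat d d" "x \<in> carrier_vec n"
  shows "x \<bullet> ((K\<^sup>T * P * K) *\<^sub>v x) = (K *\<^sub>v x) \<bullet> (P *\<^sub>v (K *\<^sub>v x))"
proof -
  have "(K\<^sup>T * P * K) *\<^sub>v x = K\<^sup>T *\<^sub>v (P *\<^sub>v (K *\<^sub>v x))"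
    using assms by (simp add: assoc_mult_mat_vec[of _ n d _ n] assoc_mult_mat_vec[of _ n d _ d])
  then show ?thesis using assms by (simp add: scalar_prod_transpose[of _ d n])
qed

lemma symm_mat_congruence:
  assumes K: "K \<in> carrier_mat d n" and P: "symm_mat d P"
  shows "symm_mat n (K\<^sup>T * P * K)"
proof -
  have "(K\<^sup>T * P * K)\<^sup>T = K\<^sup>T * (P\<^sup>T * K)"
    using K P by (simp add: symm_mat_def transpose_mult[of _ n d] transpose_mult[of _ n d _ d])
  then show ?thesis
    using K P by (auto simp: symm_mat_def assoc_mult_mat[of _ n d _ d])
qed

lemma pos_semidef_congruence:
  assumes K: "K \<in> carrier_mat d n" and P: "pos_semidef d P"
  shows "pos_semidef n (K\<^sup>T * P * K)"
proof -
  have "x \<bullet> ((K\<^sup>T * P * K) *\<^sub>v x) \<ge> 0" if "x \<in> carrier_vec n" for x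
    using that K P by (subst quad_form_congruence[of _ d n]) (auto simp: pos_semidef_def symm_mat_def)
  then show ?thesis
    using symm_mat_congruence[OF K] P by (simp add: pos_semidef_def)
qed

lemma minv_inverse:
  assumes A: "A \<in> carrier_mat d d" and det: "det A \<noteq> 0"
  shows "minv A \<in> carrier_mat d d" "A * minv A = 1\<^sub>m d" "minv A * A = 1\<^sub>m d"
proof -
  have "A \<in> Units (ring_mat TYPE(real) d ())" using det_non_zero_imp_unit[OF A det] .
  then obtain B where "mat_inverse A = Some B" using mat_inverse(1)[OF A] by fastforce
  with mat_inverse(2)[OF A this] show "minv A \<in> carrier_mat d d" "A * minv A = 1\<^sub>m d"
    "minv A * A = 1\<^sub>m d" by (auto simp: minv_def)
qed

lemma det_pos_def_nonzero:
  assumes "pos_def d A"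
  shows "det A \<noteq> 0"
proof
  assume "det A = 0"
  have A: "A \<in> carrier_mat d d" using assms by (simp add: pos_def_def symm_mat_def)
  obtain x where "x \<in> carrier_vec d" "x \<noteq> 0\<^sub>v d" "A *\<^sub>v x = 0\<^sub>v d"
    using \<open>det A = 0\<close> det_0_iff_vec_prod_zero_field[OF A] by auto
  then show False using assms by (auto simp: pos_def_def)
qed

lemma det_invertible_mat_nonzero:
  assumes "A \<in> carrier_mat d d" "invertible_mat A"
  shows "det A \<noteq> (0 :: real)"
proof -
  obtain B where AB: "A * B = 1\<^sub>m d" and BA: "B * A = 1\<^sub>m (dim_row B)"
    using assms by (auto simp: invertible_mat_def inverts_mat_def)
  have "dim_col (A * B) = d" "dim_col (B * A) = dim_row B" using AB BA by simp_all
  then have "B \<in> carrier_mat d d" using assms(1) by auto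
  then have "det A * det B = 1" using det_mult[OF assms(1)] AB det_one by metis
  then show ?thesis by auto
qed

section \<open>Trace and gradient inequalities\<close>

text \<open>
  The linear-algebraic hypotheses of the theorem, for an arbitrary index set. The condition
  \<open>le\<close> is equivalent to \<open>L\<^sub>j\<close> being a contraction from the inner product defined by \<open>M\<close> to the
  one defined by \<open>A\<^sub>j\<close>.
\<close>

locale gaussian_datum =
  fixes J :: "nat set" and n :: nat and N :: "nat \<Rightarrow> nat"
    and L A :: "nat \<Rightarrow> real mat" and p :: "nat \<Rightarrow> real" and M :: "real mat"
  assumes L: "j \<in> J \<Longrightarrow> L j \<in> carrier_mat (N j) n"
    and p: "j \<in> J \<Longrightarrow> p j \<ge> 0"
    and A: "j \<in> J \<Longrightarrow> pos_def (N j) (A j)"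
    and M: "M = mat_setsum n (\<lambda>j. p j \<cdot>\<^sub>m ((L j)\<^sup>T * A j * L j)) J"
    and inv: "invertible_mat M"
    and le: "j \<in> J \<Longrightarrow> loewner_ge (N j) (minv (A j)) (L j * minv M * (L j)\<^sup>T)"
begin

text \<open>
  If \<open>H j\<close> and \<open>w j\<close> are the Hessian and gradient of \<open>v\<^sub>j\<close> at \<open>L\<^sub>j x\<close>, then \<open>pull H\<close> and, below,
  \<open>pull_vec w\<close> are those of \<open>\<Sum>\<^sub>j p\<^sub>j v\<^sub>j(L\<^sub>j x)\<close>.
\<close>

definition pull :: "(nat \<Rightarrow> real mat) \<Rightarrow> real mat" where
  "pull H = mat_setsum n (\<lambda>j. p j \<cdot>\<^sub>m ((L j)\<^sup>T * H j * L j)) J"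

lemma M_pull: "M = pull A"
  by (simp add: M pull_def)

lemma pull_carrier [simp]: "pull H \<in> carrier_mat n n"
  by (simp add: pull_def)

lemma A_symm: "j \<in> J \<Longrightarrow> symm_mat (N j) (A j)"
  using A by (simp add: pos_def_def)

lemma A_carrier: "j \<in> J \<Longrightarrow> A j \<in> carrier_mat (N j) (N j)"
  using A_symm by (simp add: symm_mat_def)

lemma A_inverse:
  assumes "j \<in> J"
  shows "minv (A j) \<in> carrier_mat (N j) (N j)" "A j * minv (A j) = 1\<^sub>m (N j)"
    "minv (A j) * A j = 1\<^sub>m (N j)"
  using minv_inverse[OF A_carrier[OF assms] det_pos_def_nonzero[OF A[OF assms]]] .

lemma M_carrier: "M \<in> carrier_mat n n"
  by (simp add: M_pull)

lemma M_inverse: "minv M \<in> carrier_mat n n" "M * minv M = 1\<^sub>m n" "minv M * M = 1\<^sub>m n"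
  using minv_inverse[OF M_carrier det_invertible_mat_nonzero[OF M_carrier inv]] .

lemma pos_semidef_pull:
  assumes "\<And>j. j \<in> J \<Longrightarrow> pos_semidef (N j) (H j)"
  shows "pos_semidef n (pull H)"
  unfolding pull_def
  using assms p L by (intro pos_semidef_mat_setsum pos_semidef_smult pos_semidef_congruence)

lemma pull_minus:
  assumes "\<And>j. j \<in> J \<Longrightarrow> H j \<in> carrier_mat (N j) (N j)"
    and "\<And>j. j \<in> J \<Longrightarrow> H' j \<in> carrier_mat (N j) (N j)"
  shows "pull (\<lambda>j. H j - H' j) = pull H - pull H'"
proof (rule eq_matI)
  fix i k assume "i < dim_row (pull H - pull H')" "k < dim_col (pull H - pull H')"
  then have ik: "i < n" "k < n" by (auto simp: pull_def mat_setsum_def)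
  have "(p j \<cdot>\<^sub>m ((L j)\<^sup>T * (H j - H' j) * L j)) $$ (i, k)
    = (p j \<cdot>\<^sub>m ((L j)\<^sup>T * H j * L j)) $$ (i, k) - (p j \<cdot>\<^sub>m ((L j)\<^sup>T * H' j * L j)) $$ (i, k)"
    if "j \<in> J" for j
  proof -
    have "(L j)\<^sup>T * (H j - H' j) * L j = (L j)\<^sup>T * H j * L j - (L j)\<^sup>T * H' j * L j"
      using L[OF that] assms[OF that]
      by (simp add: mult_minus_distrib_mat[of _ n "N j" _ "N j"] minus_mult_distrib_mat[of _ n "N j"])
    then show ?thesis using ik L[OF that] by (simp add: right_diff_distrib)
  qed
  then show "pull (\<lambda>j. H j - H' j) $$ (i, k) = (pull H - pull H') $$ (i, k)"
    using ik by (simp add: pull_def mat_setsum_def sum_subtractf)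
qed (auto simp: pull_def mat_setsum_def)

lemma pull_smult:
  assumes "\<And>j. j \<in> J \<Longrightarrow> H j \<in> carrier_mat (N j) (N j)"
  shows "pull (\<lambda>j. c \<cdot>\<^sub>m H j) = c \<cdot>\<^sub>m pull H"
proof (rule eq_matI)
  fix i k assume "i < dim_row (c \<cdot>\<^sub>m pull H)" "k < dim_col (c \<cdot>\<^sub>m pull H)"
  then have ik: "i < n" "k < n" by (auto simp: pull_def mat_setsum_def)
  have "(p j \<cdot>\<^sub>m ((L j)\<^sup>T * (c \<cdot>\<^sub>m H j) * L j)) $$ (i, k)
    = c * (p j \<cdot>\<^sub>m ((L j)\<^sup>T * H j * L j)) $$ (i, k)" if "j \<in> J" for j
  proof -
    have "(L j)\<^sup>T * (c \<cdot>\<^sub>m H j) * L j = c \<cdot>\<^sub>m ((L j)\<^sup>T * H j * L j)"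
      using L[OF that] assms[OF that]
      by (simp add: mult_smult_distrib[of _ n "N j" _ "N j"] mult_smult_assoc_mat[of _ n "N j"])
    then show ?thesis using ik L[OF that] by simp
  qed
  then show "pull (\<lambda>j. c \<cdot>\<^sub>m H j) $$ (i, k) = (c \<cdot>\<^sub>m pull H) $$ (i, k)"
    using ik by (simp add: pull_def mat_setsum_def sum_distrib_left)
qed (auto simp: pull_def mat_setsum_def)

lemma quad_form_pull:
  assumes x: "x \<in> carrier_vec n" and H: "\<And>j. j \<in> J \<Longrightarrow> H j \<in> carrier_mat (N j) (N j)"
  shows "x \<bullet> (pull H *\<^sub>v x) = (\<Sum>j\<in>J. p j * ((L j *\<^sub>v x) \<bullet> (H j *\<^sub>v (L j *\<^sub>v x))))"
proof -
  have car: "(L j)\<^sup>T * H j * L j \<in> carrier_mat n n" if "j \<in> J" for j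
    using L[OF that] by auto
  have "x \<bullet> (pull H *\<^sub>v x) = (\<Sum>j\<in>J. x \<bullet> ((p j \<cdot>\<^sub>m ((L j)\<^sup>T * H j * L j)) *\<^sub>v x))"
    unfolding pull_def using car by (intro quad_form_mat_setsum x) auto
  also have "\<dots> = (\<Sum>j\<in>J. p j * (x \<bullet> (((L j)\<^sup>T * H j * L j) *\<^sub>v x)))"
    using car x by (intro sum.cong refl) (simp add: scalar_prod_smult_mat[of _ n])
  also have "\<dots> = (\<Sum>j\<in>J. p j * ((L j *\<^sub>v x) \<bullet> (H j *\<^sub>v (L j *\<^sub>v x))))"
    using quad_form_congruence[OF L H x] by simp
  finally show ?thesis .
qed

lemma loewner_ge_pull:
  assumes "\<And>j. j \<in> J \<Longrightarrow> loewner_ge (N j) (H j) (c \<cdot>\<^sub>m A j)"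
  shows "loewner_ge n (pull H) (c \<cdot>\<^sub>m M)"
proof -
  have "pull H - c \<cdot>\<^sub>m M = pull (\<lambda>j. H j - c \<cdot>\<^sub>m A j)"
    using assms A_carrier by (simp add: M_pull pull_minus pull_smult loewner_ge_def)
  then show ?thesis
    using assms M_carrier by (simp add: loewner_ge_def pos_semidef_pull)
qed

lemma M_symm: "symm_mat n M"
proof -
  have "pos_semidef (N j) (A j)" if "j \<in> J" for j
    unfolding pos_semidef_def
  proof (intro conjI ballI)
    fix x :: "real vec" assume "x \<in> carrier_vec (N j)"
    then show "x \<bullet> (A j *\<^sub>v x) \<ge> 0"
      using A[OF that] A_carrier[OF that] by (cases "x = 0\<^sub>v (N j)") (auto simp: pos_def_def less_imp_le)
  qed (use A_symm[OF that] in simp)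
  then show ?thesis
    using pos_semidef_pull[of A] by (simp add: M_pull pos_semidef_def)
qed

lemma frob_pull:
  assumes "P \<in> carrier_mat n n" and "\<And>j. j \<in> J \<Longrightarrow> H j \<in> carrier_mat (N j) (N j)"
  shows "frob P (pull H) = (\<Sum>j\<in>J. p j * frob (L j * P * (L j)\<^sup>T) (H j))"
  unfolding pull_def frob_mat_setsum[OF assms(1)]
proof (intro sum.cong refl)
  fix j assume j: "j \<in> J"
  have "(L j)\<^sup>T * H j * L j \<in> carrier_mat n n" using L[OF j] by auto
  then show "frob P (p j \<cdot>\<^sub>m ((L j)\<^sup>T * H j * L j)) = p j * frob (L j * P * (L j)\<^sup>T) (H j)"
    using frob_congruence[OF L[OF j] assms(1) assms(2)[OF j]] assms(1) by (simp add: frob_smult_right)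
qed

text \<open>
  Pair the positive semidefinite matrices \<open>A\<^sub>j\<^sup>-\<^sup>1 - L\<^sub>j M\<^sup>-\<^sup>1 L\<^sub>j\<^sup>*\<close> and \<open>H\<^sub>j + c A\<^sub>j\<close> and sum with
  weights \<open>p\<^sub>j\<close>. The constant comes from \<open>tr (A\<^sub>j\<^sup>-\<^sup>1 A\<^sub>j) = n\<^sub>j\<close> and from
  \<open>\<Sum>\<^sub>j p\<^sub>j tr (L\<^sub>j M\<^sup>-\<^sup>1 L\<^sub>j\<^sup>* A\<^sub>j) = tr (M\<^sup>-\<^sup>1 M) = n\<close>.
\<close>

lemma trace_inequality:
  assumes H: "\<And>j. j \<in> J \<Longrightarrow> loewner_ge (N j) (H j) (- c \<cdot>\<^sub>m A j)"
  shows "frob (minv M) (pull H)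
    \<le> (\<Sum>j\<in>J. p j * frob (minv (A j)) (H j)) + c * ((\<Sum>j\<in>J. p j * real (N j)) - real n)"
proof -
  let ?C = "\<lambda>j. L j * minv M * (L j)\<^sup>T"
  have carH: "j \<in> J \<Longrightarrow> H j \<in> carrier_mat (N j) (N j)" for j
    using H by (simp add: loewner_ge_def)
  have step: "p j * frob (?C j) (H j) + c * (p j * frob (?C j) (A j))
      \<le> p j * frob (minv (A j)) (H j) + c * (p j * real (N j))" if j: "j \<in> J" for j
  proof -
    have C: "?C j \<in> carrier_mat (N j) (N j)" using L[OF j] M_inverse(1) by auto
    have 1: "frob (minv (A j) - ?C j) (H j - - c \<cdot>\<^sub>m A j) \<ge> 0"
      by (rule frob_pos_semidef[of "N j"]) (use le[OF j] H[OF j] in \<open>simp_all add: loewner_ge_def\<close>)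
    have "frob (minv (A j) - ?C j) (H j - - c \<cdot>\<^sub>m A j)
      = frob (minv (A j)) (H j) - frob (?C j) (H j)
        + c * (frob (minv (A j)) (A j) - frob (?C j) (A j))"
      using A_inverse(1)[OF j] C A_carrier[OF j] carH[OF j]
      by (simp add: frob_diff_left[of _ "N j"] frob_diff_right[of _ "N j"] frob_smult_right[of _ "N j"]
          algebra_simps)
    also have "frob (minv (A j)) (A j) = real (N j)"
      using frob_inverse[OF A_inverse(1)[OF j] A_symm[OF j] A_inverse(3)[OF j]] .
    finally have "0 \<le> frob (minv (A j)) (H j) - frob (?C j) (H j) + c * (real (N j) - frob (?C j) (A j))"
      using 1 by simp
    from mult_left_mono[OF this p[OF j]] show ?thesis by (simp add: algebra_simps)
  qed
  have "frob (minv M) (pull H) + c * frob (minv M) M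
    = (\<Sum>j\<in>J. p j * frob (?C j) (H j) + c * (p j * frob (?C j) (A j)))"
    using frob_pull[OF M_inverse(1) carH] frob_pull[OF M_inverse(1) A_carrier]
    by (simp add: M_pull[symmetric] sum.distrib sum_distrib_left)
  also have "\<dots> \<le> (\<Sum>j\<in>J. p j * frob (minv (A j)) (H j) + c * (p j * real (N j)))"
    by (rule sum_mono) (rule step)
  also have "\<dots> = (\<Sum>j\<in>J. p j * frob (minv (A j)) (H j)) + c * (\<Sum>j\<in>J. p j * real (N j))"
    by (simp add: sum.distrib sum_distrib_left)
  finally show ?thesis
    using frob_inverse[OF M_inverse(1) M_symm M_inverse(3)] by (simp add: algebra_simps)
qed

definition pull_vec :: "(nat \<Rightarrow> real vec) \<Rightarrow> real vec" where
  "pull_vec w = vec n (\<lambda>i. \<Sum>j\<in>J. p j * ((L j)\<^sup>T *\<^sub>v w j) $ i)"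

lemma scalar_prod_pull_vec:
  assumes y: "y \<in> carrier_vec n" and w: "\<And>j. j \<in> J \<Longrightarrow> w j \<in> carrier_vec (N j)"
  shows "y \<bullet> pull_vec w = (\<Sum>j\<in>J. p j * ((L j *\<^sub>v y) \<bullet> w j))"
proof -
  have "y \<bullet> pull_vec w = (\<Sum>i<n. \<Sum>j\<in>J. p j * (y $ i * ((L j)\<^sup>T *\<^sub>v w j) $ i))"
    by (simp add: pull_vec_def scalar_prod_def lessThan_atLeast0 sum_distrib_left mult_ac)
  also have "\<dots> = (\<Sum>j\<in>J. \<Sum>i<n. p j * (y $ i * ((L j)\<^sup>T *\<^sub>v w j) $ i))"
    by (rule sum.swap)
  also have "\<dots> = (\<Sum>j\<in>J. p j * (y \<bullet> ((L j)\<^sup>T *\<^sub>v w j)))"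
    using L by (intro sum.cong refl)
      (auto simp: scalar_prod_def lessThan_atLeast0 sum_distrib_left simp del: index_mult_mat_vec)
  also have "\<dots> = (\<Sum>j\<in>J. p j * ((L j *\<^sub>v y) \<bullet> w j))"
    using scalar_prod_transpose[OF L y w] by simp
  finally show ?thesis .
qed

text \<open>
  Complete the square: with \<open>z = \<Sum>\<^sub>j p\<^sub>j L\<^sub>j\<^sup>* w\<^sub>j\<close> and \<open>y = M\<^sup>-\<^sup>1 z\<close>, both
  \<open>\<Sum>\<^sub>j p\<^sub>j \<langle>A\<^sub>j L\<^sub>j y, L\<^sub>j y\<rangle> = \<langle>M y, y\<rangle>\<close> and \<open>\<Sum>\<^sub>j p\<^sub>j \<langle>w\<^sub>j, L\<^sub>j y\<rangle> = \<langle>z, y\<rangle>\<close> equal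
  \<open>\<langle>z, M\<^sup>-\<^sup>1 z\<rangle>\<close>.
\<close>

lemma gradient_inequality:
  assumes w: "\<And>j. j \<in> J \<Longrightarrow> w j \<in> carrier_vec (N j)"
  shows "pull_vec w \<bullet> (minv M *\<^sub>v pull_vec w) \<le> (\<Sum>j\<in>J. p j * (w j \<bullet> (minv (A j) *\<^sub>v w j)))"
proof -
  let ?z = "pull_vec w"
  define y where "y = minv M *\<^sub>v ?z"
  have z: "?z \<in> carrier_vec n" by (simp add: pull_vec_def)
  have y: "y \<in> carrier_vec n" using M_inverse(1) z by (simp add: y_def)
  have My: "M *\<^sub>v y = ?z"
    using assoc_mult_mat_vec[OF M_carrier M_inverse(1) z] M_inverse(2) z by (simp add: y_def)
  let ?Ly = "\<lambda>j. L j *\<^sub>v y"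
  have yz: "y \<bullet> ?z = (\<Sum>j\<in>J. p j * (?Ly j \<bullet> w j))"
    by (rule scalar_prod_pull_vec[OF y w])
  have yMy: "y \<bullet> ?z = (\<Sum>j\<in>J. p j * (?Ly j \<bullet> (A j *\<^sub>v ?Ly j)))"
    using quad_form_pull[OF y A_carrier] My by (simp add: M_pull)
  have step: "0 \<le> p j * (?Ly j \<bullet> (A j *\<^sub>v ?Ly j)) - 2 * (p j * (?Ly j \<bullet> w j))
      + p j * (w j \<bullet> (minv (A j) *\<^sub>v w j))" if j: "j \<in> J" for j
  proof -
    define q where "q = minv (A j) *\<^sub>v w j"
    let ?d = "N j"
    have q: "q \<in> carrier_vec ?d" using A_inverse(1)[OF j] w[OF j] by (simp add: q_def)
    have Ly: "?Ly j \<in> carrier_vec ?d" using L[OF j] y by simp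
    note Aj = A_carrier[OF j]
    have Aq: "A j *\<^sub>v q = w j"
      using assoc_mult_mat_vec[OF Aj A_inverse(1)[OF j] w[OF j]] A_inverse(2)[OF j] w[OF j]
      by (simp add: q_def)
    have cross: "q \<bullet> (A j *\<^sub>v ?Ly j) = ?Ly j \<bullet> w j"
    proof -
      have "q \<bullet> (A j *\<^sub>v ?Ly j) = q \<bullet> ((A j)\<^sup>T *\<^sub>v ?Ly j)"
        using A_symm[OF j] by (simp add: symm_mat_def)
      also have "\<dots> = (A j *\<^sub>v q) \<bullet> ?Ly j" by (rule scalar_prod_transpose[OF Aj q Ly])
      finally show ?thesis using Aq comm_scalar_prod[OF w[OF j] Ly] by simp
    qed
    have "0 \<le> (?Ly j - q) \<bullet> (A j *\<^sub>v (?Ly j - q))"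
    proof (cases "?Ly j - q = 0\<^sub>v ?d")
      case True
      then show ?thesis using Aj by simp
    next
      case False
      then show ?thesis using A[OF j] Ly q by (auto simp: pos_def_def less_imp_le)
    qed
    also have "A j *\<^sub>v (?Ly j - q) = A j *\<^sub>v ?Ly j - w j"
      using mult_minus_distrib_mat_vec[OF Aj Ly q] Aq by simp
    also have "(?Ly j - q) \<bullet> \<dots> = ?Ly j \<bullet> (A j *\<^sub>v ?Ly j) - ?Ly j \<bullet> w j
       - (q \<bullet> (A j *\<^sub>v ?Ly j) - q \<bullet> w j)"
      using Ly q w[OF j] Aj
      by (simp add: minus_scalar_prod_distrib[of _ ?d] scalar_prod_minus_distrib[of _ ?d])
    also have "q \<bullet> w j = w j \<bullet> q" by (rule comm_scalar_prod[OF q w[OF j]])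
    finally have "0 \<le> ?Ly j \<bullet> (A j *\<^sub>v ?Ly j) - 2 * (?Ly j \<bullet> w j) + w j \<bullet> q"
      using cross by simp
    from mult_left_mono[OF this p[OF j]] show ?thesis
      by (simp add: q_def algebra_simps)
  qed
  have "0 \<le> (\<Sum>j\<in>J. p j * (?Ly j \<bullet> (A j *\<^sub>v ?Ly j)) - 2 * (p j * (?Ly j \<bullet> w j))
      + p j * (w j \<bullet> (minv (A j) *\<^sub>v w j)))"
    by (rule sum_nonneg) (rule step)
  also have "\<dots> = y \<bullet> ?z - 2 * (y \<bullet> ?z) + (\<Sum>j\<in>J. p j * (w j \<bullet> (minv (A j) *\<^sub>v w j)))"
    by (simp add: sum.distrib sum_subtractf sum_distrib_left[symmetric] yz yMy[symmetric, unfolded yz])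
  finally have "y \<bullet> ?z \<le> (\<Sum>j\<in>J. p j * (w j \<bullet> (minv (A j) *\<^sub>v w j)))" by simp
  moreover have "?z \<bullet> y = y \<bullet> ?z" by (rule comm_scalar_prod[OF z y])
  ultimately show ?thesis by (simp add: y_def)
qed

end

section \<open>Directional derivatives\<close>

text \<open>
  Gateaux differentiability with linear derivative, at all points. Unlike the existence of
  partial derivatives it is preserved by composition with linear maps, and unlike Frechet
  differentiability it refers to no topology on vectors. The gradient is given by component
  functions, so that the notion can be applied again to each component.
\<close>

definition has_grad :: "nat \<Rightarrow> (real vec \<Rightarrow> real) \<Rightarrow> (nat \<Rightarrow> real vec \<Rightarrow> real) \<Rightarrow> bool" where
  "has_grad d f g \<longleftrightarrow> (\<forall>y \<in> carrier_vec d. \<forall>w \<in> carrier_vec d.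
     ((\<lambda>s. f (y + s \<cdot>\<^sub>v w)) has_real_derivative (\<Sum>i<d. g i y * w $ i)) (at 0))"

lemma has_gradD:
  "\<lbrakk>has_grad d f g; y \<in> carrier_vec d; w \<in> carrier_vec d\<rbrakk> \<Longrightarrow>
    ((\<lambda>s. f (y + s \<cdot>\<^sub>v w)) has_real_derivative (\<Sum>i<d. g i y * w $ i)) (at 0)"
  by (simp add: has_grad_def)

lemma add_zero_smult_vec [simp]:
  fixes y w :: "real vec"
  shows "y \<in> carrier_vec d \<Longrightarrow> w \<in> carrier_vec d \<Longrightarrow> y + 0 \<cdot>\<^sub>v w = y"
  by (intro eq_vecI) auto

lemma has_grad_cong:
  assumes "has_grad d f g"
    and "\<And>y. y \<in> carrier_vec d \<Longrightarrow> f' y = f y"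
    and "\<And>i y. i < d \<Longrightarrow> y \<in> carrier_vec d \<Longrightarrow> g' i y = g i y"
  shows "has_grad d f' g'"
  using assms by (simp add: has_grad_def)

lemma has_grad_pd:
  assumes f: "has_grad d f g" and x: "x \<in> carrier_vec d" and i: "i < d"
  shows "pd i f x = g i x"
proof -
  have "(\<Sum>k<d. g k x * unit_vec d i $ k) = (\<Sum>k<d. if k = i then g k x else 0)"
    using i by (intro sum.cong) auto
  then have "(\<Sum>k<d. g k x * unit_vec d i $ k) = g i x" using i by simp
  then have "(along i f x has_real_derivative g i x) (at 0)"
    using has_gradD[OF f x, of "unit_vec d i"] x by (simp add: along_def)
  then show ?thesis unfolding pd_def by (rule DERIV_imp_deriv)
qed

lemma mean_value_from_zero:
  fixes f f' :: "real \<Rightarrow> real"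
  assumes "\<And>x. (f has_real_derivative f' x) (at x)"
  obtains z where "\<bar>z\<bar> \<le> \<bar>b\<bar>" "f b - f 0 = b * f' z"
proof (cases b "0 :: real" rule: linorder_cases)
  case less
  then obtain z where "b < z" "z < 0" "f 0 - f b = (0 - b) * f' z"
    using MVT2[of b 0 f f'] assms by auto
  then show ?thesis by (intro that[of z]) (auto simp: algebra_simps)
next
  case equal
  then show ?thesis by (intro that[of 0]) auto
next
  case greater
  then obtain z where "0 < z" "z < b" "f b - f 0 = (b - 0) * f' z"
    using MVT2[of 0 b f f'] assms by auto
  then show ?thesis by (intro that[of z]) auto
qed

lemma C1_fn_DERIV_line:
  assumes f: "C1_fn d f" and k: "k < d" and z: "z \<in> carrier_vec d"
  shows "((\<lambda>r. f (z + r \<cdot>\<^sub>v unit_vec d k)) has_real_derivative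
    pd k f (z + r \<cdot>\<^sub>v unit_vec d k)) (at r)"
proof -
  let ?y = "z + r \<cdot>\<^sub>v unit_vec d k"
  have y: "?y \<in> carrier_vec d" using z by simp
  then have dy: "dim_vec ?y = d" by simp
  have "along k f ?y differentiable (at 0)"
    using f k y by (simp add: C1_fn_def)
  then have "(along k f ?y has_real_derivative pd k f ?y) (at 0)"
    by (simp add: pd_def DERIV_deriv_iff_real_differentiable)
  moreover have "along k f ?y = (\<lambda>s. f (z + (s + r) \<cdot>\<^sub>v unit_vec d k))"
  proof
    fix s
    have "?y + s \<cdot>\<^sub>v unit_vec d k = z + (s + r) \<cdot>\<^sub>v unit_vec d k"
      using z by (intro eq_vecI) (auto simp: algebra_simps)
    then show "along k f ?y s = f (z + (s + r) \<cdot>\<^sub>v unit_vec d k)"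
      unfolding along_def dy by simp
  qed
  ultimately show ?thesis
    using DERIV_shift[of "\<lambda>r. f (z + r \<cdot>\<^sub>v unit_vec d k)" "pd k f ?y" 0 r] by simp
qed

text \<open>
  Let \<open>z k s\<close> be \<open>y + s w\<close> with the coordinates from \<open>k\<close> on kept as in \<open>y\<close>. Going from
  \<open>z k s\<close> to \<open>z (Suc k) s\<close> moves along one coordinate direction by \<open>s w\<^sub>k\<close>, so by the mean value
  theorem \<open>f\<close> changes by \<open>s w\<^sub>k\<close> times its \<open>k\<close>-th partial derivative at an intermediate point. That
  point tends to \<open>y\<close> as \<open>s \<longlongrightarrow> 0\<close>, and continuity of the partial derivative
  identifies the limit. Induction on \<open>k\<close> adds up the coordinates.
\<close>

lemma C1_fn_has_grad:
  assumes f: "C1_fn d f"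
  shows "has_grad d f (\<lambda>i. pd i f)"
  unfolding has_grad_def
proof (intro ballI)
  fix y w :: "real vec" assume y: "y \<in> carrier_vec d" and w: "w \<in> carrier_vec d"
  define z where "z = (\<lambda>k s. vec d (\<lambda>i. y $ i + (if i < k then s * w $ i else 0)))"
  have z0: "z k 0 = y" for k using y by (auto simp: z_def intro!: eq_vecI)
  have main: "((\<lambda>s. f (z k s)) has_real_derivative (\<Sum>i<k. pd i f y * w $ i)) (at 0)" if "k \<le> d" for k
    using that
  proof (induction k)
    case 0
    have "z 0 s = y" for s using y by (auto simp: z_def intro!: eq_vecI)
    then show ?case by simp
  next
    case (Suc k)
    then have k: "k < d" by simp
    have zc: "z k s \<in> carrier_vec d" for s by (simp add: z_def)
    define D where "D = (\<lambda>s r. pd k f (z k s + r \<cdot>\<^sub>v unit_vec d k))"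
    have zSuc: "z (Suc k) s = z k s + (s * w $ k) \<cdot>\<^sub>v unit_vec d k" for s
      using k by (intro eq_vecI) (auto simp: z_def less_Suc_eq)
    have "\<exists>r. \<bar>r\<bar> \<le> \<bar>s * w $ k\<bar> \<and> f (z (Suc k) s) - f (z k s) = s * w $ k * D s r" for s
    proof -
      obtain r where "\<bar>r\<bar> \<le> \<bar>s * w $ k\<bar>"
        "f (z k s + (s * w $ k) \<cdot>\<^sub>v unit_vec d k) - f (z k s + 0 \<cdot>\<^sub>v unit_vec d k) = s * w $ k * D s r"
        unfolding D_def
        using mean_value_from_zero[OF C1_fn_DERIV_line[OF f k zc[of s]], of "s * w $ k"] by metis
      then show ?thesis using zc[of s] by (auto simp: zSuc)
    qed
    then obtain r where r: "\<And>s. \<bar>r s\<bar> \<le> \<bar>s * w $ k\<bar>"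
      and rD: "\<And>s. f (z (Suc k) s) - f (z k s) = s * w $ k * D s (r s)" by metis
    have "(r \<longlongrightarrow> 0) (at 0)"
    proof (rule Lim_null_comparison)
      show "\<forall>\<^sub>F s in at 0. norm (r s) \<le> \<bar>s * w $ k\<bar>" using r by simp
      have "((\<lambda>s. \<bar>s * w $ k\<bar>) \<longlongrightarrow> \<bar>0 * w $ k\<bar>) (at 0)" by (intro tendsto_intros)
      then show "((\<lambda>s. \<bar>s * w $ k\<bar>) \<longlongrightarrow> 0) (at 0)" by simp
    qed
    then have lim: "((\<lambda>s. (s, r s)) \<longlongrightarrow> (0, 0)) (at 0)" by (intro tendsto_intros)
    \<comment> \<open>\<open>D\<close> is jointly continuous: it is the partial derivative after an affine parametrization\<close>
    have "continuous_on UNIV (\<lambda>v :: nat \<Rightarrow> real. pd k f (vec d v))"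
      using f k by (simp add: C1_fn_def cont_fn_def)
    moreover have "continuous_on UNIV (\<lambda>q :: real \<times> real. (\<lambda>i.
        y $ i + (if i < k then fst q * w $ i else 0) + (if i = k then snd q else 0)))"
    proof (rule continuous_on_coordinatewise_then_product)
      fix i
      show "continuous_on UNIV (\<lambda>q :: real \<times> real.
          y $ i + (if i < k then fst q * w $ i else 0) + (if i = k then snd q else 0))"
        by (cases "i < k"; cases "i = k") (auto intro!: continuous_intros)
    qed
    ultimately have "continuous_on UNIV (\<lambda>q :: real \<times> real. pd k f (vec d (\<lambda>i.
        y $ i + (if i < k then fst q * w $ i else 0) + (if i = k then snd q else 0))))"
      by (rule continuous_on_compose2) simp
    moreover have "vec d (\<lambda>i. y $ i + (if i < k then s * w $ i else 0) + (if i = k then q else 0))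
       = z k s + q \<cdot>\<^sub>v unit_vec d k" for s q
      using k by (intro eq_vecI) (auto simp: z_def)
    ultimately have "continuous_on UNIV (\<lambda>q. D (fst q) (snd q))"
      by (simp add: D_def)
    then have "isCont (\<lambda>q. D (fst q) (snd q)) (0, 0)"
      by (simp add: continuous_on_eq_continuous_at)
    from isCont_tendsto_compose[OF this lim]
    have "((\<lambda>s. D s (r s)) \<longlongrightarrow> D 0 0) (at 0)" by simp
    moreover have "D 0 0 = pd k f y" using y by (simp add: D_def z0)
    ultimately have Dlim: "((\<lambda>s. D s (r s)) \<longlongrightarrow> pd k f y) (at 0)" by simp
    have IH: "((\<lambda>s. (f (z k s) - f y) / s) \<longlongrightarrow> (\<Sum>i<k. pd i f y * w $ i)) (at 0)"
      using Suc.IH k by (simp add: has_field_derivative_iff z0)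
    have "((\<lambda>s. (f (z k s) - f y) / s + D s (r s) * w $ k) \<longlongrightarrow>
       (\<Sum>i<k. pd i f y * w $ i) + pd k f y * w $ k) (at 0)"
      by (intro tendsto_intros IH Dlim)
    moreover have "\<forall>\<^sub>F s in at 0. (f (z k s) - f y) / s + D s (r s) * w $ k
       = (f (z (Suc k) s) - f y) / s"
      unfolding eventually_at_filter
    proof (intro always_eventually allI impI)
      fix s :: real assume "s \<noteq> 0"
      then show "(f (z k s) - f y) / s + D s (r s) * w $ k = (f (z (Suc k) s) - f y) / s"
        using rD[of s] by (simp add: field_simps)
    qed
    ultimately have "((\<lambda>s. (f (z (Suc k) s) - f y) / s) \<longlongrightarrow>
       (\<Sum>i<k. pd i f y * w $ i) + pd k f y * w $ k) (at 0)"
      by (rule Lim_transform_eventually)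
    then show ?case by (simp add: has_field_derivative_iff z0)
  qed
  have "z d s = y + s \<cdot>\<^sub>v w" for s using y w by (intro eq_vecI) (auto simp: z_def)
  then show "((\<lambda>s. f (y + s \<cdot>\<^sub>v w)) has_real_derivative (\<Sum>i<d. pd i f y * w $ i)) (at 0)"
    using main[of d] by simp
qed

lemma has_grad_ln:
  assumes f: "has_grad d f g" and pos: "\<And>y. y \<in> carrier_vec d \<Longrightarrow> f y > 0"
  shows "has_grad d (\<lambda>y. ln (f y)) (\<lambda>i y. g i y / f y)"
  unfolding has_grad_def
proof (intro ballI)
  fix y w :: "real vec" assume y: "y \<in> carrier_vec d" and w: "w \<in> carrier_vec d"
  have "((\<lambda>s. ln (f (y + s \<cdot>\<^sub>v w))) has_real_derivative
      1 / f (y + 0 \<cdot>\<^sub>v w) * (\<Sum>i<d. g i y * w $ i)) (at 0)"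
    using has_gradD[OF f y w] pos[OF y] y w by (auto intro!: derivative_eq_intros)
  then show "((\<lambda>s. ln (f (y + s \<cdot>\<^sub>v w))) has_real_derivative (\<Sum>i<d. g i y / f y * w $ i)) (at 0)"
    using y w by (simp add: sum_divide_distrib)
qed

lemma has_grad_exp:
  assumes f: "has_grad d f g"
  shows "has_grad d (\<lambda>y. exp (f y)) (\<lambda>i y. exp (f y) * g i y)"
  unfolding has_grad_def
proof (intro ballI)
  fix y w :: "real vec" assume y: "y \<in> carrier_vec d" and w: "w \<in> carrier_vec d"
  have "((\<lambda>s. exp (f (y + s \<cdot>\<^sub>v w))) has_real_derivative
      exp (f (y + 0 \<cdot>\<^sub>v w)) * (\<Sum>i<d. g i y * w $ i)) (at 0)"
    using has_gradD[OF f y w] by (auto intro!: derivative_eq_intros)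
  then show "((\<lambda>s. exp (f (y + s \<cdot>\<^sub>v w))) has_real_derivative
      (\<Sum>i<d. exp (f y) * g i y * w $ i)) (at 0)"
    using y w by (simp add: sum_distrib_left mult_ac)
qed

lemma has_grad_mult:
  assumes f: "has_grad d f g" and f': "has_grad d f' g'"
  shows "has_grad d (\<lambda>y. f y * f' y) (\<lambda>i y. g i y * f' y + f y * g' i y)"
  unfolding has_grad_def
proof (intro ballI)
  fix y w :: "real vec" assume y: "y \<in> carrier_vec d" and w: "w \<in> carrier_vec d"
  have "((\<lambda>s. f (y + s \<cdot>\<^sub>v w) * f' (y + s \<cdot>\<^sub>v w)) has_real_derivative
      (\<Sum>i<d. g i y * w $ i) * f' (y + 0 \<cdot>\<^sub>v w) + (\<Sum>i<d. g' i y * w $ i) * f (y + 0 \<cdot>\<^sub>v w)) (at 0)"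
    by (rule DERIV_mult[OF has_gradD[OF f y w] has_gradD[OF f' y w]])
  also have "(\<Sum>i<d. g i y * w $ i) * f' (y + 0 \<cdot>\<^sub>v w) + (\<Sum>i<d. g' i y * w $ i) * f (y + 0 \<cdot>\<^sub>v w)
     = (\<Sum>i<d. (g i y * f' y + f y * g' i y) * w $ i)"
    using y w by (simp add: sum_distrib_left sum_distrib_right sum.distrib[symmetric] algebra_simps)
  finally show "((\<lambda>s. f (y + s \<cdot>\<^sub>v w) * f' (y + s \<cdot>\<^sub>v w)) has_real_derivative
      (\<Sum>i<d. (g i y * f' y + f y * g' i y) * w $ i)) (at 0)" .
qed

lemma has_grad_divide:
  assumes f: "has_grad d f g" and f': "has_grad d f' g'"
    and nz: "\<And>y. y \<in> carrier_vec d \<Longrightarrow> f' y \<noteq> 0"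
  shows "has_grad d (\<lambda>y. f y / f' y) (\<lambda>i y. (g i y * f' y - f y * g' i y) / (f' y * f' y))"
  unfolding has_grad_def
proof (intro ballI)
  fix y w :: "real vec" assume y: "y \<in> carrier_vec d" and w: "w \<in> carrier_vec d"
  have "((\<lambda>s. f (y + s \<cdot>\<^sub>v w) / f' (y + s \<cdot>\<^sub>v w)) has_real_derivative
      ((\<Sum>i<d. g i y * w $ i) * f' (y + 0 \<cdot>\<^sub>v w) - f (y + 0 \<cdot>\<^sub>v w) * (\<Sum>i<d. g' i y * w $ i))
       / (f' (y + 0 \<cdot>\<^sub>v w) * f' (y + 0 \<cdot>\<^sub>v w))) (at 0)"
    by (rule DERIV_divide[OF has_gradD[OF f y w] has_gradD[OF f' y w]]) (use y w nz in simp)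
  also have "((\<Sum>i<d. g i y * w $ i) * f' (y + 0 \<cdot>\<^sub>v w) - f (y + 0 \<cdot>\<^sub>v w) * (\<Sum>i<d. g' i y * w $ i))
       / (f' (y + 0 \<cdot>\<^sub>v w) * f' (y + 0 \<cdot>\<^sub>v w))
     = (\<Sum>i<d. (g i y * f' y - f y * g' i y) / (f' y * f' y) * w $ i)"
    using y w nz[OF y] by (simp add: sum_distrib_left sum_distrib_right sum_subtractf[symmetric]
        sum_divide_distrib algebra_simps)
  finally show "((\<lambda>s. f (y + s \<cdot>\<^sub>v w) / f' (y + s \<cdot>\<^sub>v w)) has_real_derivative
      (\<Sum>i<d. (g i y * f' y - f y * g' i y) / (f' y * f' y) * w $ i)) (at 0)" .
qed

lemma has_grad_affine_sum:
  assumes f: "\<And>j. j \<in> J \<Longrightarrow> has_grad d (f j) (g j)"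
  shows "has_grad d (\<lambda>y. c + (\<Sum>j\<in>J. a j * f j y)) (\<lambda>i y. \<Sum>j\<in>J. a j * g j i y)"
  unfolding has_grad_def
proof (intro ballI)
  fix y w :: "real vec" assume y: "y \<in> carrier_vec d" and w: "w \<in> carrier_vec d"
  have "((\<lambda>s. c + (\<Sum>j\<in>J. a j * f j (y + s \<cdot>\<^sub>v w))) has_real_derivative
      0 + (\<Sum>j\<in>J. a j * (\<Sum>i<d. g j i y * w $ i))) (at 0)"
    by (intro DERIV_add DERIV_const DERIV_sum DERIV_cmult has_gradD[OF f y w])
  also have "0 + (\<Sum>j\<in>J. a j * (\<Sum>i<d. g j i y * w $ i)) = (\<Sum>i<d. (\<Sum>j\<in>J. a j * g j i y) * w $ i)"
    by (simp add: sum_distrib_left sum_distrib_right mult_ac sum.swap[of _ J])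
  finally show "((\<lambda>s. c + (\<Sum>j\<in>J. a j * f j (y + s \<cdot>\<^sub>v w))) has_real_derivative
      (\<Sum>i<d. (\<Sum>j\<in>J. a j * g j i y) * w $ i)) (at 0)" .
qed

lemma has_grad_compose_linear:
  assumes f: "has_grad d f g" and K: "K \<in> carrier_mat d n"
  shows "has_grad n (\<lambda>x. f (K *\<^sub>v x)) (\<lambda>i x. \<Sum>k<d. K $$ (k, i) * g k (K *\<^sub>v x))"
  unfolding has_grad_def
proof (intro ballI)
  fix y w :: "real vec" assume y: "y \<in> carrier_vec n" and w: "w \<in> carrier_vec n"
  have Ky: "K *\<^sub>v y \<in> carrier_vec d" and Kw: "K *\<^sub>v w \<in> carrier_vec d" using K y w by auto
  have "K *\<^sub>v (y + s \<cdot>\<^sub>v w) = K *\<^sub>v y + s \<cdot>\<^sub>v (K *\<^sub>v w)" for s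
    using K y w by (simp add: mult_add_distrib_mat_vec[of _ d n] mult_mat_vec[of _ d n])
  then have "((\<lambda>s. f (K *\<^sub>v (y + s \<cdot>\<^sub>v w))) has_real_derivative
      (\<Sum>k<d. g k (K *\<^sub>v y) * (K *\<^sub>v w) $ k)) (at 0)"
    using has_gradD[OF f Ky Kw] by simp
  also have "(\<Sum>k<d. g k (K *\<^sub>v y) * (K *\<^sub>v w) $ k)
    = (\<Sum>k<d. \<Sum>i<n. K $$ (k, i) * g k (K *\<^sub>v y) * w $ i)"
    using K w by (intro sum.cong refl)
      (auto simp: scalar_prod_def lessThan_atLeast0 sum_distrib_left mult_ac intro!: sum.cong)
  also have "\<dots> = (\<Sum>i<n. (\<Sum>k<d. K $$ (k, i) * g k (K *\<^sub>v y)) * w $ i)"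
    unfolding sum_distrib_right by (rule sum.swap)
  finally show "((\<lambda>s. f (K *\<^sub>v (y + s \<cdot>\<^sub>v w))) has_real_derivative
      (\<Sum>i<n. (\<Sum>k<d. K $$ (k, i) * g k (K *\<^sub>v y)) * w $ i)) (at 0)" .
qed

section \<open>Second-order calculus of logarithms\<close>

text \<open>
  The partial derivatives serve as their own gradient components here, so that statements about
  functions of this kind can be phrased with \<open>grad\<close> and \<open>hessian\<close>.
\<close>

definition twice_diff :: "nat \<Rightarrow> (real vec \<Rightarrow> real) \<Rightarrow> bool" where
  "twice_diff d f \<longleftrightarrow> has_grad d f (\<lambda>i. pd i f) \<and>
     (\<forall>k<d. has_grad d (pd k f) (\<lambda>i. pd i (pd k f)))"

text \<open>
  The way to compute gradients and Hessians: exhibit component functions \<open>g\<close> and \<open>h\<close> by the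
  differentiation rules. Here \<open>h k i\<close> is the \<open>i\<close>-th derivative of \<open>g k\<close>, matching the index order
  in \<open>hessian\<close>.
\<close>

lemma second_order_pd:
  assumes f: "has_grad d f g" and g: "\<And>k. k < d \<Longrightarrow> has_grad d (g k) (h k)"
  shows "twice_diff d f"
    and "x \<in> carrier_vec d \<Longrightarrow> i < d \<Longrightarrow> pd i f x = g i x"
    and "x \<in> carrier_vec d \<Longrightarrow> i < d \<Longrightarrow> k < d \<Longrightarrow> pd i (pd k f) x = h k i x"
proof -
  note pdf = has_grad_pd[OF f]
  have g': "has_grad d (pd k f) (h k)" if "k < d" for k
    using has_grad_cong[OF g[OF that], of "pd k f" "h k"] pdf that by simp
  have pdg: "pd i (pd k f) x = h k i x" if "x \<in> carrier_vec d" "i < d" "k < d" for i k x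
    using has_grad_pd[OF g'] that by simp
  show "twice_diff d f" unfolding twice_diff_def
    using has_grad_cong[OF f, of f] has_grad_cong[OF g'] pdf pdg by auto
  show "x \<in> carrier_vec d \<Longrightarrow> i < d \<Longrightarrow> pd i f x = g i x" by (rule pdf)
  show "x \<in> carrier_vec d \<Longrightarrow> i < d \<Longrightarrow> k < d \<Longrightarrow> pd i (pd k f) x = h k i x" by (rule pdg)
qed

lemma C2_fn_twice_diff_ln:
  assumes f: "C2_fn d f" and pos: "\<And>y. y \<in> carrier_vec d \<Longrightarrow> f y > 0"
  shows "twice_diff d (\<lambda>y. ln (f y))"
proof (rule second_order_pd(1))
  have f1: "has_grad d f (\<lambda>i. pd i f)" using f C1_fn_has_grad by (simp add: C2_fn_def)
  then show "has_grad d (\<lambda>y. ln (f y)) (\<lambda>i y. pd i f y / f y)"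
    by (rule has_grad_ln[OF _ pos])
  fix k assume "k < d"
  then have "has_grad d (pd k f) (\<lambda>i. pd i (pd k f))"
    using f C1_fn_has_grad by (simp add: C2_fn_def)
  then show "has_grad d (\<lambda>y. pd k f y / f y)
    (\<lambda>i y. (pd i (pd k f) y * f y - pd k f y * pd i f y) / (f y * f y))"
    by (rule has_grad_divide[OF _ f1]) (use pos in fastforce)
qed

lemma grad_carrier [simp]: "x \<in> carrier_vec d \<Longrightarrow> grad f x \<in> carrier_vec d"
  by (simp add: grad_def)

lemma hessian_carrier [simp]: "x \<in> carrier_vec d \<Longrightarrow> hessian f x \<in> carrier_mat d d"
  by (simp add: hessian_def)

text \<open>
  From \<open>\<nabla>w = w \<nabla>v\<close> one gets \<open>\<partial>\<^sub>i(w \<partial>\<^sub>k v) = w (\<partial>\<^sub>i v \<partial>\<^sub>k v + \<partial>\<^sub>i \<partial>\<^sub>k v)\<close>; contract with \<open>B\<close>.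
\<close>

lemma divergence_via_log:
  assumes pos: "\<And>y. y \<in> carrier_vec d \<Longrightarrow> w y > 0" and v: "twice_diff d (\<lambda>y. ln (w y))"
    and B: "B \<in> carrier_mat d d" and x: "x \<in> carrier_vec d"
  defines "v \<equiv> \<lambda>y. ln (w y)"
  shows "divergence (\<lambda>y. B *\<^sub>v grad w y) x
    = w x * (frob B (hessian v x) + grad v x \<bullet> (B *\<^sub>v grad v x))"
proof -
  have v1: "has_grad d v (\<lambda>i. pd i v)"
    and v2: "\<And>k. k < d \<Longrightarrow> has_grad d (pd k v) (\<lambda>i. pd i (pd k v))"
    using v by (auto simp: twice_diff_def v_def)
  have ev: "exp (v y) = w y" if "y \<in> carrier_vec d" for y using pos[OF that] by (simp add: v_def)
  have w1: "has_grad d w (\<lambda>i y. w y * pd i v y)"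
    using has_grad_cong[OF has_grad_exp[OF v1], of w] ev by simp
  have flux: "has_grad d (\<lambda>y. (B *\<^sub>v grad w y) $ i)
     (\<lambda>l y. \<Sum>k<d. B $$ (i, k) * (w y * pd l v y * pd k v y + w y * pd l (pd k v) y))"
    if i: "i < d" for i
  proof (rule has_grad_cong)
    show "has_grad d (\<lambda>y. 0 + (\<Sum>k<d. B $$ (i, k) * (w y * pd k v y)))
       (\<lambda>l y. \<Sum>k<d. B $$ (i, k) * (w y * pd l v y * pd k v y + w y * pd l (pd k v) y))"
      by (intro has_grad_affine_sum has_grad_mult w1 v2) simp
    show "(B *\<^sub>v grad w y) $ i = 0 + (\<Sum>k<d. B $$ (i, k) * (w y * pd k v y))"
      if "y \<in> carrier_vec d" for y
      using B i that has_grad_pd[OF w1 that]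
      by (auto simp: scalar_prod_def lessThan_atLeast0 grad_def intro!: sum.cong)
  qed simp
  have "divergence (\<lambda>y. B *\<^sub>v grad w y) x
    = (\<Sum>i<d. \<Sum>k<d. B $$ (i, k) * (w x * pd i v x * pd k v x + w x * pd i (pd k v) x))"
    using x by (simp add: divergence_def has_grad_pd[OF flux x])
  also have "\<dots> = w x * ((\<Sum>i<d. \<Sum>k<d. B $$ (i, k) * pd i (pd k v) x)
     + (\<Sum>i<d. \<Sum>k<d. B $$ (i, k) * pd i v x * pd k v x))"
    unfolding sum.distrib[symmetric] sum_distrib_left
    by (intro sum.cong refl) (simp add: algebra_simps)
  also have "(\<Sum>i<d. \<Sum>k<d. B $$ (i, k) * pd i (pd k v) x) = frob B (hessian v x)"
    using B x by (simp add: frob_def hessian_def)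
  also have "(\<Sum>i<d. \<Sum>k<d. B $$ (i, k) * pd i v x * pd k v x) = grad v x \<bullet> (B *\<^sub>v grad v x)"
    using x by (subst quad_form_sum[OF B]) (auto simp: grad_def)
  finally show ?thesis .
qed

context gaussian_datum
begin

text \<open>
  The chain rule, twice. The constant \<open>c\<close> takes the logarithm of the power of \<open>t\<close>. As
  \<open>V\<close> is prescribed on \<open>carrier_vec n\<close> only, the lemma applies to a logarithm that has this form
  just at vectors of the right dimension.
\<close>

lemma second_order_pull:
  assumes f: "\<And>j. j \<in> J \<Longrightarrow> twice_diff (N j) (f j)"
    and V: "\<And>x. x \<in> carrier_vec n \<Longrightarrow> V x = c + (\<Sum>j\<in>J. p j * f j (L j *\<^sub>v x))"
  shows "twice_diff n V"
    and "x \<in> carrier_vec n \<Longrightarrow> grad V x = pull_vec (\<lambda>j. grad (f j) (L j *\<^sub>v x))"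
    and "x \<in> carrier_vec n \<Longrightarrow> hessian V x = pull (\<lambda>j. hessian (f j) (L j *\<^sub>v x))"
proof -
  define g where "g = (\<lambda>i x. \<Sum>j\<in>J. p j * (\<Sum>k<N j. L j $$ (k, i) * pd k (f j) (L j *\<^sub>v x)))"
  define h where "h = (\<lambda>k i x. \<Sum>j\<in>J. p j * (\<Sum>s<N j. L j $$ (s, k) *
      (\<Sum>r<N j. L j $$ (r, i) * pd r (pd s (f j)) (L j *\<^sub>v x))))"
  have f1: "\<And>j. j \<in> J \<Longrightarrow> has_grad (N j) (f j) (\<lambda>i. pd i (f j))"
    and f2: "\<And>j k. j \<in> J \<Longrightarrow> k < N j \<Longrightarrow> has_grad (N j) (pd k (f j)) (\<lambda>i. pd i (pd k (f j)))"
    using f by (auto simp: twice_diff_def)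
  have V1: "has_grad n V g"
  proof (rule has_grad_cong[OF _ V])
    show "has_grad n (\<lambda>x. c + (\<Sum>j\<in>J. p j * f j (L j *\<^sub>v x))) g"
      unfolding g_def by (intro has_grad_affine_sum has_grad_compose_linear f1 L)
  qed simp_all
  \<comment> \<open>the inner sum is again of the affine form, with constant \<open>0\<close>\<close>
  have V2: "has_grad n (g k) (h k)" for k
  proof -
    have "has_grad n (\<lambda>x. 0 + (\<Sum>j\<in>J. p j * (0 + (\<Sum>s<N j. L j $$ (s, k) * pd s (f j) (L j *\<^sub>v x))))) (h k)"
      unfolding h_def by (intro has_grad_affine_sum has_grad_compose_linear f2 L) auto
    then show ?thesis by (simp add: g_def)
  qed
  show "twice_diff n V" by (rule second_order_pd(1)[OF V1 V2])
  assume x: "x \<in> carrier_vec n"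
  have Lx: "L j *\<^sub>v x \<in> carrier_vec (N j)" if "j \<in> J" for j using L[OF that] x by simp
  show "grad V x = pull_vec (\<lambda>j. grad (f j) (L j *\<^sub>v x))"
  proof (rule eq_vecI)
    fix i assume "i < dim_vec (pull_vec (\<lambda>j. grad (f j) (L j *\<^sub>v x)))"
    then have i: "i < n" by (simp add: pull_vec_def)
    have "((L j)\<^sup>T *\<^sub>v grad (f j) (L j *\<^sub>v x)) $ i = (\<Sum>k<N j. L j $$ (k, i) * pd k (f j) (L j *\<^sub>v x))"
      if "j \<in> J" for j
      using L[OF that] i Lx[OF that] by (auto simp: scalar_prod_def lessThan_atLeast0 grad_def intro!: sum.cong)
    then show "grad V x $ i = pull_vec (\<lambda>j. grad (f j) (L j *\<^sub>v x)) $ i"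
      using i x second_order_pd(2)[OF V1 V2 x i] by (simp add: pull_vec_def grad_def g_def)
  qed (use x in \<open>simp add: pull_vec_def grad_def\<close>)
  show "hessian V x = pull (\<lambda>j. hessian (f j) (L j *\<^sub>v x))"
  proof (rule eq_matI)
    fix i k assume "i < dim_row (pull (\<lambda>j. hessian (f j) (L j *\<^sub>v x)))"
      "k < dim_col (pull (\<lambda>j. hessian (f j) (L j *\<^sub>v x)))"
    then have ik: "i < n" "k < n" by (auto simp: pull_def mat_setsum_def)
    have "(p j \<cdot>\<^sub>m ((L j)\<^sup>T * hessian (f j) (L j *\<^sub>v x) * L j)) $$ (i, k) = p j * (\<Sum>s<N j. L j $$ (s, k) *
      (\<Sum>r<N j. L j $$ (r, i) * pd r (pd s (f j)) (L j *\<^sub>v x)))" if j: "j \<in> J" for j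
    proof -
      have "((L j)\<^sup>T * hessian (f j) (L j *\<^sub>v x) * L j) $$ (i, k)
        = (\<Sum>r<N j. \<Sum>s<N j. L j $$ (r, i) * hessian (f j) (L j *\<^sub>v x) $$ (r, s) * L j $$ (s, k))"
        by (rule index_congruence[OF L[OF j] hessian_carrier[OF Lx[OF j]] ik])
      also have "\<dots> = (\<Sum>r<N j. \<Sum>s<N j. L j $$ (s, k) * (L j $$ (r, i) * pd r (pd s (f j)) (L j *\<^sub>v x)))"
        using L[OF j] by (intro sum.cong refl) (simp add: hessian_def)
      also have "\<dots> = (\<Sum>s<N j. L j $$ (s, k) * (\<Sum>r<N j. L j $$ (r, i) * pd r (pd s (f j)) (L j *\<^sub>v x)))"
        unfolding sum_distrib_left by (rule sum.swap)
      finally show ?thesis using L[OF j] ik by simp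
    qed
    then show "hessian V x $$ (i, k) = pull (\<lambda>j. hessian (f j) (L j *\<^sub>v x)) $$ (i, k)"
      using ik x second_order_pd(3)[OF V1 V2 x ik] by (simp add: pull_def mat_setsum_def hessian_def h_def)
  qed (use x in \<open>auto simp: pull_def mat_setsum_def hessian_def\<close>)
qed

end

section \<open>Supersolutions generated by supersolutions\<close>

theorem theorem3p7:
  fixes m n :: nat
    and N :: "nat \<Rightarrow> nat"
    and L A :: "nat \<Rightarrow> real mat"
    and p :: "nat \<Rightarrow> real"
    and u :: "nat \<Rightarrow> real \<Rightarrow> real vec \<Rightarrow> real"
    and M :: "real mat"
    and u' :: "real \<Rightarrow> real vec \<Rightarrow> real"
  assumes "m \<ge> 1" and "n \<ge> 1"
    and "\<forall>j\<in>{1..m}. L j \<in> carrier_mat (N j) n"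
    and "\<forall>j\<in>{1..m}. (\<lambda>x. L j *\<^sub>v x) ` carrier_vec n = carrier_vec (N j)"
    and "\<forall>j\<in>{1..m}. p j \<ge> 0"
    and "\<forall>j\<in>{1..m}. pos_def (N j) (A j)"
    and M_def: "M = mat_setsum n (\<lambda>j. p j \<cdot>\<^sub>m ((L j)\<^sup>T * A j * L j)) {1..m}"
    and "invertible_mat M"
    and "\<forall>j\<in>{1..m}. loewner_ge (N j) (minv (A j)) (L j * minv M * (L j)\<^sup>T)"
    and "\<forall>j\<in>{1..m}. \<forall>t>0. \<forall>y\<in>carrier_vec (N j). u j t y > 0"
    and "\<forall>j\<in>{1..m}. regular (N j) (u j)"
    and u'_def: "u' = (\<lambda>t x. t powr (1 / 2 * ((\<Sum>j=1..m. p j * real (N j)) - real n)) *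
                    (\<Prod>j=1..m. u j t (L j *\<^sub>v x) powr p j))"
    and "\<forall>j\<in>{1..m}. heat_supersol (N j) (minv (A j)) (u j)"
    and "\<forall>j\<in>{1..m}. log_hessian_bound (N j) (A j) (u j)"
  shows "heat_supersol n (minv M) u' \<and> log_hessian_bound n M u'"
proof -
  let ?J = "{1..m}"
  define a where "a = 1 / 2 * ((\<Sum>j=1..m. p j * real (N j)) - real n)"
  interpret gaussian_datum ?J n N L A p M
    by unfold_locales (use assms in auto)
  have upos: "u j t y > 0" if "j \<in> ?J" "t > 0" "y \<in> carrier_vec (N j)" for j t y
    using assms that by blast
  have Lx: "L j *\<^sub>v x \<in> carrier_vec (N j)" if "j \<in> ?J" "x \<in> carrier_vec n" for j x
    using L[OF that(1)] that(2) by simp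
  have u'_exp: "u' t x = exp (a * ln t + (\<Sum>j\<in>?J. p j * ln (u j t (L j *\<^sub>v x))))"
    if t: "t > 0" and x: "x \<in> carrier_vec n" for t x
  proof -
    have "u j t (L j *\<^sub>v x) powr p j = exp (p j * ln (u j t (L j *\<^sub>v x)))" if "j \<in> ?J" for j
      using upos[OF that t Lx[OF that x]] by (simp add: powr_def)
    moreover have "u' t x = t powr a * (\<Prod>j\<in>?J. u j t (L j *\<^sub>v x) powr p j)"
      by (simp only: u'_def a_def)
    moreover have "t powr a = exp (a * ln t)" using t by (simp add: powr_def)
    ultimately show ?thesis by (simp add: exp_add exp_sum)
  qed
  have tw: "twice_diff (N j) (\<lambda>y. ln (u j t y))" if "j \<in> ?J" "t > 0" for j t
    using assms that by (intro C2_fn_twice_diff_ln) (auto simp: regular_def)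
  have ln_u': "ln (u' t x) = a * ln t + (\<Sum>j\<in>?J. p j * ln (u j t (L j *\<^sub>v x)))"
    if "t > 0" "x \<in> carrier_vec n" for t x
    using u'_exp[OF that] by simp
  have u'_pos: "u' t x > 0" if "t > 0" "x \<in> carrier_vec n" for t x
    using u'_exp[OF that] by simp
  have second: "twice_diff n (\<lambda>x. ln (u' t x))"
    "x \<in> carrier_vec n \<Longrightarrow> grad (\<lambda>x. ln (u' t x)) x
      = pull_vec (\<lambda>j. grad (\<lambda>y. ln (u j t y)) (L j *\<^sub>v x))"
    "x \<in> carrier_vec n \<Longrightarrow> hessian (\<lambda>x. ln (u' t x)) x
      = pull (\<lambda>j. hessian (\<lambda>y. ln (u j t y)) (L j *\<^sub>v x))"
    if t: "t > 0" for t x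
    using second_order_pull[where f = "\<lambda>j y. ln (u j t y)" and V = "\<lambda>x. ln (u' t x)",
        OF tw[OF _ t] ln_u'[OF t]] by blast+
  have hess: "loewner_ge (N j) (hessian (\<lambda>y. ln (u j t y)) y) (- (1 / (2 * t)) \<cdot>\<^sub>m A j)"
    if "j \<in> ?J" "t > 0" "y \<in> carrier_vec (N j)" for j t y
    using assms that by (auto simp: log_hessian_bound_def)
  have "log_hessian_bound n M u'"
    unfolding log_hessian_bound_def
  proof (intro allI impI ballI)
    fix t :: real and x :: "real vec" assume t: "t > 0" and x: "x \<in> carrier_vec n"
    show "loewner_ge n (hessian (\<lambda>y. ln (u' t y)) x) (- (1 / (2 * t)) \<cdot>\<^sub>m M)"
      unfolding second(3)[OF t x]
      by (intro loewner_ge_pull hess Lx t x)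
  qed
  moreover have "heat_supersol n (minv M) u'"
    unfolding heat_supersol_def
  proof (intro allI impI ballI)
    fix t :: real and x :: "real vec" assume t: "t > 0" and x: "x \<in> carrier_vec n"
    let ?y = "\<lambda>j. L j *\<^sub>v x"
    let ?H = "\<lambda>j. hessian (\<lambda>y. ln (u j t y)) (?y j)"
    let ?w = "\<lambda>j. grad (\<lambda>y. ln (u j t y)) (?y j)"
    let ?du = "\<lambda>j. deriv (\<lambda>s. u j s (?y j)) t"
    have u_DERIV: "((\<lambda>s. u j s (?y j)) has_real_derivative ?du j) (at t)" if j: "j \<in> ?J" for j
    proof -
      have "(\<lambda>s. u j s (?y j)) C1_differentiable_on {0<..}"
        using assms j Lx[OF j x] by (auto simp: regular_def)
      then have "(\<lambda>s. u j s (?y j)) differentiable (at t)"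
        using t by (simp add: C1_differentiable_on_eq)
      then show ?thesis by (simp add: DERIV_deriv_iff_real_differentiable)
    qed
    have ln_u_DERIV: "((\<lambda>s. ln (u j s (?y j))) has_real_derivative 1 / u j t (?y j) * ?du j) (at t)"
      if j: "j \<in> ?J" for j
      by (rule DERIV_chain2[OF DERIV_ln_divide u_DERIV]) (use upos[OF j t Lx[OF j x]] j in auto)
    have "((\<lambda>s. exp (a * ln s + (\<Sum>j\<in>?J. p j * ln (u j s (?y j))))) has_real_derivative
       exp (a * ln t + (\<Sum>j\<in>?J. p j * ln (u j t (?y j))))
         * (a * (1 / t) + (\<Sum>j\<in>?J. p j * (1 / u j t (?y j) * ?du j)))) (at t)"
      by (intro DERIV_fun_exp DERIV_add DERIV_sum DERIV_cmult DERIV_ln_divide ln_u_DERIV t)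
    then have "((\<lambda>s. exp (a * ln s + (\<Sum>j\<in>?J. p j * ln (u j s (?y j))))) has_real_derivative
        u' t x * (a / t + (\<Sum>j\<in>?J. p j * (?du j / u j t (?y j))))) (at t)"
      by (simp add: u'_exp[OF t x])
    then have "((\<lambda>s. u' s x) has_real_derivative
        u' t x * (a / t + (\<Sum>j\<in>?J. p j * (?du j / u j t (?y j))))) (at t)"
      by (rule has_field_derivative_transform_within_open[where S = "{0<..}"])
        (use t x in \<open>simp_all add: u'_exp\<close>)
    then have du': "deriv (\<lambda>s. u' s x) t = u' t x * (a / t + (\<Sum>j\<in>?J. p j * (?du j / u j t (?y j))))"
      by (rule DERIV_imp_deriv)
    have u_heat: "frob (minv (A j)) (?H j) + ?w j \<bullet> (minv (A j) *\<^sub>v ?w j) \<le> ?du j / u j t (?y j)"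
      if j: "j \<in> ?J" for j
    proof -
      have "?du j \<ge> divergence (\<lambda>y. minv (A j) *\<^sub>v grad (u j t) y) (?y j)"
        using assms j t Lx[OF j x] by (auto simp: heat_supersol_def)
      also have "divergence (\<lambda>y. minv (A j) *\<^sub>v grad (u j t) y) (?y j)
         = u j t (?y j) * (frob (minv (A j)) (?H j) + ?w j \<bullet> (minv (A j) *\<^sub>v ?w j))"
        by (rule divergence_via_log[OF upos[OF j t] tw[OF j t] A_inverse(1)[OF j] Lx[OF j x]])
      finally show ?thesis
        using upos[OF j t Lx[OF j x]] by (simp add: pos_le_divide_eq mult.commute)
    qed
    have "divergence (\<lambda>y. minv M *\<^sub>v grad (u' t) y) x
       = u' t x * (frob (minv M) (pull ?H) + pull_vec ?w \<bullet> (minv M *\<^sub>v pull_vec ?w))"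
      using divergence_via_log[OF u'_pos[OF t] second(1)[OF t] M_inverse(1) x]
        second(2,3)[OF t x] by simp
    also have "\<dots> \<le> u' t x * (a / t + (\<Sum>j\<in>?J. p j * (?du j / u j t (?y j))))"
    proof (rule mult_left_mono)
      have "frob (minv M) (pull ?H)
        \<le> (\<Sum>j\<in>?J. p j * frob (minv (A j)) (?H j)) + 1 / (2 * t) * ((\<Sum>j\<in>?J. p j * real (N j)) - real n)"
        by (intro trace_inequality hess Lx t x)
      also have "1 / (2 * t) * ((\<Sum>j\<in>?J. p j * real (N j)) - real n) = a / t"
        by (simp add: a_def)
      finally have "frob (minv M) (pull ?H) + pull_vec ?w \<bullet> (minv M *\<^sub>v pull_vec ?w)
        \<le> a / t + (\<Sum>j\<in>?J. p j * (frob (minv (A j)) (?H j) + ?w j \<bullet> (minv (A j) *\<^sub>v ?w j)))"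
        using gradient_inequality[of ?w] Lx x by (simp add: distrib_left sum.distrib)
      also have "\<dots> \<le> a / t + (\<Sum>j\<in>?J. p j * (?du j / u j t (?y j)))"
        by (intro add_left_mono sum_mono mult_left_mono u_heat p)
      finally show "frob (minv M) (pull ?H) + pull_vec ?w \<bullet> (minv M *\<^sub>v pull_vec ?w)
        \<le> a / t + (\<Sum>j\<in>?J. p j * (?du j / u j t (?y j)))" .
    qed (use u'_pos[OF t x] in simp)
    finally show "deriv (\<lambda>s. u' s x) t \<ge> divergence (\<lambda>y. minv M *\<^sub>v grad (u' t) y) x"
      by (simp add: du')
  qed
  ultimately show ?thesis by simp
qed

end
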